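(* Let $(\Sigma,\sigma)$ be a transitive countable Markov shift, with compactification $(\bar\Sigma,\bar\sigma)$. Then: (a) $(\Sigma,\sigma)$ satisfies the $\mathcal{F}$-property if and only if the unique ergodic measure in $\mathcal{M}(\bar\Sigma,\bar\sigma)\setminus\mathcal{M}(\Sigma,\sigma)$ is $\delta_{\bar\infty}$. (b) $(\Sigma,\sigma)$ does not satisfy the $\mathcal{F}$-property if and only if the set of ergodic measures in $\mathcal{M}(\bar\Sigma,\bar\sigma)\setminus\mathcal{M}(\Sigma,\sigma)$ is dense in $\mathcal{M}(\bar\Sigma,\bar\sigma)$ (with the weak$^*$ topology).
   Context: Countable Markov shift: let $M$ be an $\mathbb{N}\times\mathbb{N}$ matrix with entries in $\{0,1\}$, $\mathbb{N}=\{1,2,\dots\}$; $\Sigma=\{(x_1,x_2,\dots)\in\mathbb{N}^{\mathbb{N}}: M(x_i,x_{i+1})=1\ \forall i\in\mathbb{N}\}$ with the topology induced by the product of discrete topologies, and $\sigma(x_1,x_2,\dots)=(x_2,x_3,\dots)$. An admissible word is a finite string $a_1\dots a_N$ in $\mathbb{N}$ with $M(a_i,a_{i+1})=1$ for $1\le i<N$. The shift is transitive if for all $a,b\in\mathbb{N}$ there is an admissible word starting with $a$ and ending with $b$ (in particular $\Sigma$ is non-compact). $\mathcal{M}(\Sigma,\sigma)$ is the set of $\sigma$-invariant Borel probability measures on $\Sigma$. $\mathcal{F}$-property: for every $a\in\mathbb{N}$ and $n\in\mathbb{N}$ there are only finitely many admissible words of length $n$ that begin and end with $a$. Compactification: equip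 $\mathbb{N}\cup\{\infty\}$ with the metric $\bar\rho(a,b)=|1/a-1/b|$ (with $1/\infty=0$) and $(\mathbb{N}\cup\{\infty\})^{\mathbb{N}}$ with $\bar d_\rho(x,y)=\sum_{n\in\mathbb{N}}2^{-n}\bar\rho(x_n,y_n)$ (a compact metric space). $\bar\Sigma$ is the closure of $\Sigma$ in this space, and $\bar\sigma:\bar\Sigma\to\bar\Sigma$ is the left shift, the continuous extension of $\sigma$. $\mathcal{M}(\bar\Sigma,\bar\sigma)$ is the space of $\bar\sigma$-invariant Borel probability measures on $\bar\Sigma$ with the weak$^*$ topology, and $\mathcal{M}(\Sigma,\sigma)$ is identified with $\{\mu\in\mathcal{M}(\bar\Sigma,\bar\sigma):\mu(\Sigma)=1\}$. $\bar\infty=(\infty,\infty,\dots)$ and $\delta_{\bar\infty}$ is the Dirac measure at $\bar\infty$ (an element of $\mathcal{M}(\bar\Sigma,\bar\sigma)$ when $\bar\infty\in\bar\Sigma$). *)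

theory Defs
  imports "HOL-Probability.Probability"
begin

text \<open>
  Sequences are indexed from \<open>0\<close>, so the symbol \<open>x\<^sub>n\<close> of the mathematical text is \<open>x (n - 1)\<close>.
  The alphabet is the set of positive natural numbers (of positive extended naturals for the
  compactification): the symbol \<open>0\<close> is excluded everywhere.
\<close>

definition transition_matrix :: "(nat \<Rightarrow> nat \<Rightarrow> nat) \<Rightarrow> bool" where
  "transition_matrix M \<longleftrightarrow> (\<forall>a\<ge>1. \<forall>b\<ge>1. M a b \<in> {0, 1})"

definition markov_shift :: "(nat \<Rightarrow> nat \<Rightarrow> nat) \<Rightarrow> (nat \<Rightarrow> nat) set" where
  "markov_shift M = {x. (\<forall>i. 1 \<le> x i) \<and> (\<forall>i. M (x i) (x (Suc i)) = 1)}"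

definition left_shift :: "(nat \<Rightarrow> 'a) \<Rightarrow> nat \<Rightarrow> 'a" where
  "left_shift x = (\<lambda>n. x (Suc n))"

definition admissible_word :: "(nat \<Rightarrow> nat \<Rightarrow> nat) \<Rightarrow> nat list \<Rightarrow> bool" where
  "admissible_word M w \<longleftrightarrow> w \<noteq> [] \<and> (\<forall>a\<in>set w. 1 \<le> a) \<and>
     (\<forall>i. Suc i < length w \<longrightarrow> M (w ! i) (w ! Suc i) = 1)"

definition transitive_shift :: "(nat \<Rightarrow> nat \<Rightarrow> nat) \<Rightarrow> bool" where
  "transitive_shift M \<longleftrightarrow>
     (\<forall>a\<ge>1. \<forall>b\<ge>1. \<exists>w. admissible_word M w \<and> hd w = a \<and> last w = b)"

definition F_property :: "(nat \<Rightarrow> nat \<Rightarrow> nat) \<Rightarrow> bool" where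
  "F_property M \<longleftrightarrow>
     (\<forall>a\<ge>1. \<forall>n\<ge>1. finite {w. admissible_word M w \<and> length w = n \<and> hd w = a \<and> last w = a})"


subsection \<open>The compactification\<close>

definition recip :: "enat \<Rightarrow> real" where
  "recip a = (case a of enat n \<Rightarrow> 1 / real n | \<infinity> \<Rightarrow> 0)"

definition rho_bar :: "enat \<Rightarrow> enat \<Rightarrow> real" where
  "rho_bar a b = \<bar>recip a - recip b\<bar>"

definition ext_sequences :: "(nat \<Rightarrow> enat) set" where
  "ext_sequences = {x. \<forall>n. 1 \<le> x n}"

text \<open>The weight \<open>2\<^sup>-\<^sup>n\<close> becomes \<open>(1/2) ^ Suc n\<close> because indices start at \<open>0\<close>.\<close>

definition d_bar :: "(nat \<Rightarrow> enat) \<Rightarrow> (nat \<Rightarrow> enat) \<Rightarrow> real" where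
  "d_bar x y = (\<Sum>n. (1/2) ^ Suc n * rho_bar (x n) (y n))"

definition ext_topology :: "(nat \<Rightarrow> enat) topology" where
  "ext_topology = Metric_space.mtopology ext_sequences d_bar"

definition embed_seq :: "(nat \<Rightarrow> nat) \<Rightarrow> nat \<Rightarrow> enat" where
  "embed_seq x = (\<lambda>n. enat (x n))"

definition compactification :: "(nat \<Rightarrow> nat \<Rightarrow> nat) \<Rightarrow> (nat \<Rightarrow> enat) set" where
  "compactification M = ext_topology closure_of (embed_seq ` markov_shift M)"

definition compactification_topology :: "(nat \<Rightarrow> nat \<Rightarrow> nat) \<Rightarrow> (nat \<Rightarrow> enat) topology" where
  "compactification_topology M = subtopology ext_topology (compactification M)"


subsection \<open>Invariant measures\<close>

definition compactification_borel :: "(nat \<Rightarrow> nat \<Rightarrow> nat) \<Rightarrow> (nat \<Rightarrow> enat) measure" where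
  "compactification_borel M =
     sigma (compactification M) {U. openin (compactification_topology M) U}"

definition invariant_measures :: "(nat \<Rightarrow> nat \<Rightarrow> nat) \<Rightarrow> (nat \<Rightarrow> enat) measure set" where
  "invariant_measures M = {\<mu>. sets \<mu> = sets (compactification_borel M) \<and> prob_space \<mu> \<and>
     (\<forall>A\<in>sets \<mu>. emeasure \<mu> (left_shift -` A \<inter> space \<mu>) = emeasure \<mu> A)}"

text \<open>
  The shift-invariant Borel probability measures on the non-compact shift space, identified with
  the measures on the compactification that give it full mass.
\<close>

definition invariant_measures_shift :: "(nat \<Rightarrow> nat \<Rightarrow> nat) \<Rightarrow> (nat \<Rightarrow> enat) measure set" where
  "invariant_measures_shift M =
     {\<mu> \<in> invariant_measures M. emeasure \<mu> (embed_seq ` markov_shift M) = 1}"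

definition ergodic_measures :: "(nat \<Rightarrow> nat \<Rightarrow> nat) \<Rightarrow> (nat \<Rightarrow> enat) measure set" where
  "ergodic_measures M = {\<mu> \<in> invariant_measures M.
     \<forall>A\<in>sets \<mu>. left_shift -` A \<inter> space \<mu> = A \<longrightarrow> emeasure \<mu> A = 0 \<or> emeasure \<mu> A = 1}"

text \<open>
  The coarsest topology on the invariant measures that makes integration against every
  continuous function on the compactification continuous.
\<close>

definition weak_star_topology :: "(nat \<Rightarrow> nat \<Rightarrow> nat) \<Rightarrow> (nat \<Rightarrow> enat) measure topology" where
  "weak_star_topology M = topology_generated_by
     {{\<mu> \<in> invariant_measures M. (\<integral>x. f x \<partial>\<mu>) \<in> U} | f U.
        continuous_map (compactification_topology M) euclideanreal f \<and> open U}"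

text \<open>
  If \<open>(\<infinity>, \<infinity>, \<dots>)\<close> is not a point of the compactification, this is the null measure and hence
  not an element of \<open>invariant_measures M\<close>.
\<close>

definition dirac_infinity :: "(nat \<Rightarrow> nat \<Rightarrow> nat) \<Rightarrow> (nat \<Rightarrow> enat) measure" where
  "dirac_infinity M = return (compactification_borel M) (\<lambda>_. \<infinity>)"


subsection \<open>Well-definedness\<close>

lemma recip_bounds: "0 \<le> recip a" "recip a \<le> 1"
  by (auto simp: recip_def divide_le_eq split: enat.splits)

lemma rho_bar_bounds: "0 \<le> rho_bar a b" "rho_bar a b \<le> 1"
  using recip_bounds[of a] recip_bounds[of b] by (auto simp: rho_bar_def)

lemma recip_inj: "1 \<le> a \<Longrightarrow> 1 \<le> b \<Longrightarrow> recip a = recip b \<Longrightarrow> a = b"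
  by (cases a; cases b) (auto simp: recip_def one_enat_def)

lemma summable_d_bar: "summable (\<lambda>n. (1/2) ^ Suc n * rho_bar (x n) (y n))"
proof (rule summable_comparison_test)
  show "\<exists>N. \<forall>n\<ge>N. norm ((1/2) ^ Suc n * rho_bar (x n) (y n)) \<le> (1/2) ^ Suc n"
    using rho_bar_bounds by (auto simp: mult_left_le abs_mult)
  show "summable (\<lambda>n. (1/2) ^ Suc n :: real)"
    by (subst summable_Suc_iff) simp
qed

lemma Metric_space_d_bar: "Metric_space ext_sequences d_bar"
proof
  fix x y z :: "nat \<Rightarrow> enat"
  show "0 \<le> d_bar x y"
    unfolding d_bar_def
    by (rule suminf_nonneg[OF summable_d_bar]) (simp add: rho_bar_bounds)
  show "d_bar x y = d_bar y x"
    by (simp add: d_bar_def rho_bar_def abs_minus_commute)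
  assume x: "x \<in> ext_sequences" and y: "y \<in> ext_sequences"
  show "d_bar x y = 0 \<longleftrightarrow> x = y"
  proof
    assume "d_bar x y = 0"
    then have "\<forall>n. (1/2) ^ Suc n * rho_bar (x n) (y n) = 0"
      unfolding d_bar_def
      by (subst (asm) suminf_eq_zero_iff[OF summable_d_bar]) (simp_all add: rho_bar_bounds)
    then have "recip (x n) = recip (y n)" for n
      by (simp add: rho_bar_def)
    then show "x = y"
      using x y recip_inj by (auto simp: ext_sequences_def)
  qed (simp add: d_bar_def rho_bar_def)
  assume "z \<in> ext_sequences"
  have "d_bar x z \<le> (\<Sum>n. (1/2) ^ Suc n * rho_bar (x n) (y n) + (1/2) ^ Suc n * rho_bar (y n) (z n))"
    unfolding d_bar_def
    by (intro suminf_le summable_d_bar summable_add) (auto simp: rho_bar_def simp flip: distrib_left)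
  then show "d_bar x z \<le> d_bar x y + d_bar y z"
    using suminf_add[OF summable_d_bar summable_d_bar, of x y y z] by (simp only: d_bar_def)
qed

interpretation ext: Metric_space ext_sequences d_bar
  by (rule Metric_space_d_bar)

lemma topspace_ext_topology [simp]: "topspace ext_topology = ext_sequences"
  by (simp add: ext_topology_def)

lemma embed_in_compactification: "embed_seq ` markov_shift M \<subseteq> compactification M"
proof -
  have "embed_seq x \<in> ext_sequences" if "x \<in> markov_shift M" for x
    using that by (simp add: embed_seq_def markov_shift_def ext_sequences_def one_enat_def)
  then show ?thesis
    unfolding compactification_def by (intro closure_of_subset) auto
qed

lemma compactification_subset: "compactification M \<subseteq> ext_sequences"
  using closure_of_subset_topspace[of ext_topology] by (simp add: compactification_def)

lemma topspace_compactification [simp]: "topspace (compactification_topology M) = compactification M"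
  using compactification_subset[of M] by (auto simp: compactification_topology_def)

lemma space_compactification_borel [simp]: "space (compactification_borel M) = compactification M"
  unfolding compactification_borel_def using openin_subset[of "compactification_topology M"]
  by (intro space_measure_of) auto

lemma d_bar_shift: "d_bar (left_shift x) (left_shift y) \<le> 2 * d_bar x y"
proof -
  have "d_bar x y = 1/2 * rho_bar (x 0) (y 0) + (\<Sum>n. (1/2) ^ Suc (Suc n) * rho_bar (x (Suc n)) (y (Suc n)))"
    unfolding d_bar_def using suminf_split_head[OF summable_d_bar[of x y]]
    by (simp only: power_Suc power_0)
  also have "(\<Sum>n. (1/2) ^ Suc (Suc n) * rho_bar (x (Suc n)) (y (Suc n))) =
      (\<Sum>n. 1/2 * ((1/2) ^ Suc n * rho_bar (left_shift x n) (left_shift y n)))"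
    by (simp only: left_shift_def power_Suc mult.assoc)
  also have "\<dots> = 1/2 * d_bar (left_shift x) (left_shift y)"
    unfolding d_bar_def by (rule suminf_mult[OF summable_d_bar])
  finally show ?thesis
    using rho_bar_bounds(1)[of "x 0" "y 0"] by simp
qed

lemma continuous_map_shift_ext: "continuous_map ext_topology ext_topology left_shift"
proof -
  have "Lipschitz_continuous_map (metric (ext_sequences, d_bar)) (metric (ext_sequences, d_bar)) left_shift"
    unfolding Lipschitz_continuous_map_def ext.mspace_metric ext.mdist_metric
    using d_bar_shift by (intro conjI exI[of _ 2]) (auto simp: ext_sequences_def left_shift_def)
  from Lipschitz_continuous_imp_continuous_map[OF this] show ?thesis
    by (simp add: ext_topology_def ext.mtopology_of)
qed

lemma shift_compactification: "left_shift ` compactification M \<subseteq> compactification M"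
proof -
  have "left_shift ` (embed_seq ` markov_shift M) \<subseteq> embed_seq ` markov_shift M"
    by (force simp: left_shift_def embed_seq_def markov_shift_def)
  then show ?thesis
    unfolding compactification_def
    using continuous_map_image_closure_subset[OF continuous_map_shift_ext] closure_of_mono by fastforce
qed

lemma continuous_map_shift:
  "continuous_map (compactification_topology M) (compactification_topology M) left_shift"
  unfolding compactification_topology_def
proof (rule continuous_map_into_subtopology)
  show "continuous_map (subtopology ext_topology (compactification M)) ext_topology left_shift"
    by (rule continuous_map_from_subtopology[OF continuous_map_shift_ext])
  show "left_shift \<in> topspace (subtopology ext_topology (compactification M)) \<rightarrow> compactification M"
    using shift_compactification[of M] by auto
qed

lemma topspace_weak_star_topology [simp]: "topspace (weak_star_topology M) = invariant_measures M"
proof -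
  have "invariant_measures M \<in> {{\<mu> \<in> invariant_measures M. (\<integral>x. f x \<partial>\<mu>) \<in> U} | f U.
      continuous_map (compactification_topology M) euclideanreal f \<and> open U}"
    by (intro CollectI exI[of _ "\<lambda>_. 0"] exI[of _ UNIV]) auto
  then show ?thesis
    unfolding weak_star_topology_def topology_generated_by_topspace
    by (intro equalityI Union_upper Union_least) auto
qed

lemma rho_bar_le_d_bar: "rho_bar (x n) (y n) \<le> 2 ^ Suc n * d_bar x y"
proof -
  have "(1/2) ^ Suc n * rho_bar (x n) (y n) \<le> d_bar x y"
    unfolding d_bar_def using sum_le_suminf[OF summable_d_bar, of "{n}" x y] rho_bar_bounds(1)
    by (simp add: mult_nonneg_nonneg)
  then show ?thesis
    by (simp add: field_simps)
qed

lemma continuous_map_recip: "continuous_map ext_topology euclideanreal (\<lambda>x. recip (x n))"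
proof -
  have "Lipschitz_continuous_map (metric (ext_sequences, d_bar)) euclidean_metric (\<lambda>x. recip (x n))"
    unfolding Lipschitz_continuous_map_def ext.mspace_metric ext.mdist_metric
    using rho_bar_le_d_bar[of _ n]
    by (intro conjI exI[of _ "2 ^ Suc n"]) (auto simp: rho_bar_def dist_real_def simp del: power_Suc)
  from Lipschitz_continuous_imp_continuous_map[OF this] show ?thesis
    by (simp add: ext_topology_def ext.mtopology_of)
qed

lemma openin_coordinate_eq:
  assumes "1 \<le> a"
  shows "openin ext_topology {x \<in> ext_sequences. x n = enat a}"
proof -
  define U where "U = {1 / real (Suc a)<..} - (\<lambda>b. 1 / real b) ` {..<a}"
  have "recip b \<in> U \<longleftrightarrow> b = enat a" if "1 \<le> b" for b
  proof (cases b)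
    case (enat k)
    with that have "1 \<le> k"
      by (simp add: one_enat_def)
    with assms enat show ?thesis
      by (auto simp: U_def recip_def image_iff field_simps not_less_iff_gr_or_eq)
  qed (simp add: U_def recip_def)
  then have eq: "{x \<in> ext_sequences. x n = enat a} = {x \<in> topspace ext_topology. recip (x n) \<in> U}"
    by (auto simp: ext_sequences_def)
  have "open U"
    unfolding U_def by (intro open_Diff finite_imp_closed) auto
  then show ?thesis
    unfolding eq by (intro openin_continuous_map_preimage[OF continuous_map_recip]) simp
qed

lemma embed_markov_shift_eq:
  "embed_seq ` markov_shift M = {x \<in> compactification M. \<forall>n. x n \<noteq> \<infinity>}"
proof (intro equalityI subsetI)
  fix x assume "x \<in> embed_seq ` markov_shift M"
  then show "x \<in> {x \<in> compactification M. \<forall>n. x n \<noteq> \<infinity>}"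
    using subsetD[OF embed_in_compactification[of M], of x] unfolding embed_seq_def by fastforce
next
  fix x assume "x \<in> {x \<in> compactification M. \<forall>n. x n \<noteq> \<infinity>}"
  then have x: "x \<in> compactification M" and "\<forall>n. \<exists>k. x n = enat k"
    by simp_all
  then obtain y where y: "\<And>n. x n = enat (y n)"
    using choice[of "\<lambda>n k. x n = enat k"] by blast
  have pos: "1 \<le> y n" for n
  proof -
    have "1 \<le> x n"
      using subsetD[OF compactification_subset x] by (simp add: ext_sequences_def)
    then show ?thesis
      by (simp add: y one_enat_def)
  qed
  have "M (y n) (y (Suc n)) = 1" for n
  proof -
    let ?V = "{z \<in> ext_sequences. z n = enat (y n)} \<inter> {z \<in> ext_sequences. z (Suc n) = enat (y (Suc n))}"
    have "openin ext_topology ?V"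
      by (intro openin_Int openin_coordinate_eq pos)
    moreover have "x \<in> ?V"
      using subsetD[OF compactification_subset x] by (simp add: y)
    ultimately have "\<exists>z. z \<in> embed_seq ` markov_shift M \<and> z \<in> ?V"
      using x unfolding compactification_def in_closure_of by meson
    then obtain w where "w \<in> markov_shift M" "embed_seq w \<in> ?V"
      by blast
    then have "\<forall>i. M (w i) (w (Suc i)) = 1" and "w n = y n" and "w (Suc n) = y (Suc n)"
      by (simp_all add: markov_shift_def embed_seq_def)
    then show ?thesis
      by metis
  qed
  then have "y \<in> markov_shift M"
    using pos by (simp add: markov_shift_def)
  moreover have "x = embed_seq y"
    using y by (simp add: embed_seq_def fun_eq_iff)
  ultimately show "x \<in> embed_seq ` markov_shift M"
    by blast
qed

lemma sets_compactification_borel_openin: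
  "openin (compactification_topology M) U \<Longrightarrow> U \<in> sets (compactification_borel M)"
proof -
  have "{U. openin (compactification_topology M) U} \<subseteq> Pow (compactification M)"
    using openin_subset[of "compactification_topology M"] by auto
  then show "openin (compactification_topology M) U \<Longrightarrow> U \<in> sets (compactification_borel M)"
    by (auto simp: compactification_borel_def intro: sigma_sets.Basic)
qed

lemma embed_markov_shift_measurable: "embed_seq ` markov_shift M \<in> sets (compactification_borel M)"
proof -
  let ?P = "\<lambda>n. {x \<in> topspace (compactification_topology M). recip (x n) \<in> {0<..}}"
  have "openin (compactification_topology M) (?P n)" for n
    unfolding compactification_topology_def
    by (intro openin_continuous_map_preimage[OF continuous_map_from_subtopology[OF continuous_map_recip]]) simp
  then have "(\<Inter>n. ?P n) \<in> sets (compactification_borel M)"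
    by (intro sets.countable_INT) (blast intro: sets_compactification_borel_openin, rule UNIV_not_empty)
  also have "(\<Inter>n. ?P n) = embed_seq ` markov_shift M"
  proof -
    have *: "0 < recip (x n) \<longleftrightarrow> x n \<noteq> \<infinity>" if "x \<in> compactification M" for x n
    proof -
      have "1 \<le> x n"
        using subsetD[OF compactification_subset that] by (simp add: ext_sequences_def)
      then show ?thesis
        by (cases "x n") (auto simp: recip_def one_enat_def)
    qed
    show ?thesis
      unfolding embed_markov_shift_eq using * by (intro set_eqI) (simp, blast)
  qed
  finally show ?thesis .
qed

lemma measurable_shift: "left_shift \<in> compactification_borel M \<rightarrow>\<^sub>M compactification_borel M"
proof -
  have "left_shift \<in> compactification_borel M \<rightarrow>\<^sub>M
      sigma (compactification M) {U. openin (compactification_topology M) U}"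
  proof (rule measurable_measure_of)
    show "{U. openin (compactification_topology M) U} \<subseteq> Pow (compactification M)"
      using openin_subset[of "compactification_topology M"] by auto
    show "left_shift \<in> space (compactification_borel M) \<rightarrow> compactification M"
      using shift_compactification[of M] by auto
    fix U assume "U \<in> {U. openin (compactification_topology M) U}"
    then have "openin (compactification_topology M) {x \<in> topspace (compactification_topology M). left_shift x \<in> U}"
      by (intro openin_continuous_map_preimage[OF continuous_map_shift]) simp
    moreover have "left_shift -` U \<inter> space (compactification_borel M) =
        {x \<in> topspace (compactification_topology M). left_shift x \<in> U}"
      by auto
    ultimately show "left_shift -` U \<inter> space (compactification_borel M) \<in> sets (compactification_borel M)"
      by (simp add: sets_compactification_borel_openin)
  qed
  then show ?thesis
    by (simp flip: compactification_borel_def)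
qed

lemma dirac_infinity_invariant:
  "dirac_infinity M \<in> invariant_measures M \<longleftrightarrow> (\<lambda>_. \<infinity>) \<in> compactification M"
proof
  assume "dirac_infinity M \<in> invariant_measures M"
  then have "emeasure (dirac_infinity M) (compactification M) = 1"
    using prob_space.emeasure_space_1[of "dirac_infinity M"]
    by (simp add: invariant_measures_def dirac_infinity_def)
  then show "(\<lambda>_. \<infinity>) \<in> compactification M"
    using sets.top[of "compactification_borel M"]
    by (auto simp: dirac_infinity_def indicator_def split: if_splits)
next
  assume inf: "(\<lambda>_. \<infinity>) \<in> compactification M"
  then have "prob_space (dirac_infinity M)"
    by (simp add: dirac_infinity_def prob_space_return)
  moreover have "emeasure (dirac_infinity M) (left_shift -` A \<inter> compactification M) =
      emeasure (dirac_infinity M) A" if "A \<in> sets (compactification_borel M)" for A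
    using measurable_sets[OF measurable_shift that] that inf
    by (simp add: dirac_infinity_def indicator_def left_shift_def)
  ultimately show "dirac_infinity M \<in> invariant_measures M"
    by (simp add: invariant_measures_def) (simp add: dirac_infinity_def)
qed

end

theory Submission
  imports Defs
begin

text \<open>
  If the F-property fails, the ergodic measures outside the shift space are dense; if it holds, the
  only one of them is the Dirac measure at \<open>(\<infinity>, \<infinity>, \<dots>)\<close>. Both equivalences follow, because the
  closure of this one measure does not contain the measures on periodic orbits in the shift space
  (\<open>closure_dirac_infinity\<close>).

  Suppose that the F-property holds. A point of the compactification cannot have an infinite coordinate
  between two finite ones: its approximations in the shift space would be walks of one length with
  fixed ends and unbounded entries, and transitivity would close them up to infinitely many loops
  of one length (\<open>infinity_between_finite_imp_not_F\<close>). So the sets where a finite symbol at \<open>j\<close> is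
  followed by \<open>\<infinity>\<close> are disjoint for different \<open>j\<close>; having equal measure, they are null sets for every
  invariant measure. An ergodic measure that does not live on the shift space gives it measure \<open>0\<close>, and
  then almost every point has no finite coordinate (\<open>ergodic_not_on_shift_eq_dirac_infinity\<close>). The point
  \<open>(\<infinity>, \<infinity>, \<dots>)\<close> does lie in the compactification, again by the F-property
  (\<open>infinity_in_compactification\<close>).

  Suppose that the F-property fails. Infinitely many loops of one length at one symbol accumulate at a
  loop that passes through \<open>\<infinity>\<close> (\<open>infinite_ext_loop\<close>). Periodic orbits through \<open>\<infinity>\<close> are shown to approximate
  every invariant measure \<open>\<mu>\<close> on finitely many continuous functions. For a single function \<open>f\<close>,
  the integral of \<open>f\<close> is at most the supremum of the averages of \<open>f\<close> over loops of finite symbols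
  (\<open>integral_le_loop_averages\<close>). To see this, integrate Birkhoff averages: a long orbit segment, cut at its first
  and last small symbol, has a middle part that is closed up to a loop at bounded cost, and outer parts
  of large symbols only, which are closed up by a path without repetitions; this path may be long, but
  it has few small symbols, so \<open>f\<close> is almost constant on the resulting loop
  (\<open>birkhoff_sum_bound\<close>). For several functions, loops can be spliced in any proportion
  (\<open>loop_averages_splice\<close>), so that a gradient argument brings the averages along loops through \<open>\<infinity>\<close>
  arbitrarily close to the integrals (\<open>loops_through_infinity_approximate\<close>). No ergodic theorem
  and no ergodic decomposition is involved.
\<close>

section \<open>Walks in the transition graph\<close>

text \<open>
  \<open>walk M a u b\<close> says that \<open>u\<close> followed by the symbol \<open>b\<close> is an admissible word that begins with \<open>a\<close>.
  The endpoint \<open>b\<close> is not an entry of \<open>u\<close>: walks that fit together are concatenated with \<open>@\<close>,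
  the length of \<open>u\<close> is the number of steps, and a nonempty closed walk can be repeated periodically.
\<close>

fun walk :: "(nat \<Rightarrow> nat \<Rightarrow> nat) \<Rightarrow> nat \<Rightarrow> nat list \<Rightarrow> nat \<Rightarrow> bool" where
  "walk M a [] b \<longleftrightarrow> a = b \<and> 1 \<le> a"
| "walk M a (x # xs) b \<longleftrightarrow> x = a \<and> 1 \<le> a \<and> (\<exists>c. M a c = 1 \<and> walk M c xs b)"

lemma walk_pos: "walk M a u b \<Longrightarrow> 1 \<le> a"
  by (cases u) auto

lemma walk_append: "walk M a (u @ v) b \<longleftrightarrow> (\<exists>c. walk M a u c \<and> walk M c v b)"
  by (induction u arbitrary: a) (use walk_pos in fastforce)+

lemma all_nat_split: "(\<forall>i::nat. P i) \<longleftrightarrow> P 0 \<and> (\<forall>i. P (Suc i))"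
  by (metis not0_implies_Suc)

lemma admissible_word_Cons_Cons:
  "admissible_word M (x # y # zs) \<longleftrightarrow> 1 \<le> x \<and> M x y = 1 \<and> admissible_word M (y # zs)"
proof -
  have "(\<forall>i. Suc i < length (x # y # zs) \<longrightarrow> P ((x # y # zs) ! i) ((x # y # zs) ! Suc i)) \<longleftrightarrow>
      P x y \<and> (\<forall>i. Suc i < length (y # zs) \<longrightarrow> P ((y # zs) ! i) ((y # zs) ! Suc i))" for P
    by (subst all_nat_split) simp
  from this[of "\<lambda>x y. M x y = 1"] show ?thesis unfolding admissible_word_def by auto
qed

lemma walk_iff_admissible: "walk M a u b \<longleftrightarrow> admissible_word M (u @ [b]) \<and> hd (u @ [b]) = a"
proof (induction u arbitrary: a)
  case Nil
  then show ?case by (auto simp: admissible_word_def)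
next
  case (Cons x u)
  show ?case
  proof (cases u)
    case Nil
    then show ?thesis by (auto simp: admissible_word_Cons_Cons) (auto simp: admissible_word_def)
  next
    case (Cons y ys)
    with Cons.IH show ?thesis by (auto simp: admissible_word_Cons_Cons)
  qed
qed

lemma walk_nth:
  assumes "walk M a u b" "i < length u"
  shows "1 \<le> u ! i" "M (u ! i) ((u @ [b]) ! Suc i) = 1"
  using assms unfolding walk_iff_admissible admissible_word_def
  by (auto simp: nth_append dest!: spec[of _ i])

lemma walk_hd: "walk M a u b \<Longrightarrow> u \<noteq> [] \<Longrightarrow> u ! 0 = a"
  by (cases u) auto

lemma walk_exists:
  assumes "transitive_shift M" "1 \<le> a" "1 \<le> b"
  shows "\<exists>u. walk M a u b"
proof -
  from assms obtain w where "admissible_word M w" "hd w = a" "last w = b"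
    unfolding transitive_shift_def by blast
  moreover from this have "butlast w @ [b] = w"
    by (auto simp: admissible_word_def)
  ultimately have "walk M a (butlast w) b"
    by (simp add: walk_iff_admissible)
  then show ?thesis ..
qed

lemma distinct_walk_exists:
  assumes "walk M a u b"
  shows "\<exists>v. walk M a v b \<and> distinct v"
  using assms
proof (induction "length u" arbitrary: u rule: less_induct)
  case less
  show ?case
  proof (cases "distinct u")
    case False
    then obtain xs y ys zs where u: "u = xs @ [y] @ ys @ [y] @ zs"
      using not_distinct_decomp by blast
    with less.prems have "walk M a (xs @ [y] @ zs) b"
      by (auto simp: walk_append)
    with less.hyps[of "xs @ [y] @ zs"] u show ?thesis by simp
  qed (use less.prems in blast)
qed

lemma walk_of_markov_shift:
  assumes "x \<in> markov_shift M" "i \<le> j"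
  shows "walk M (x i) (map x [i..<j]) (x j)"
  using assms(2)
proof (induction j rule: dec_induct)
  case base
  then show ?case using assms(1) by (simp add: markov_shift_def)
next
  case (step j)
  then show ?case using assms(1) by (auto simp: walk_append markov_shift_def)
qed

text \<open>The periodic repetition of a nonempty word.\<close>

definition periodic_seq :: "'a list \<Rightarrow> nat \<Rightarrow> 'a" where
  "periodic_seq w i = w ! (i mod length w)"

lemma periodic_seq_markov_shift:
  assumes "walk M a u a" "u \<noteq> []"
  shows "periodic_seq u \<in> markov_shift M"
proof -
  have *: "i mod length u < length u" for i using assms(2) by simp
  have "M (periodic_seq u i) (periodic_seq u (Suc i)) = 1" for i
  proof -
    have "(u @ [a]) ! Suc (i mod length u) = u ! (Suc i mod length u)"
    proof (cases "Suc (i mod length u) = length u")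
      case True
      then have "(u @ [a]) ! Suc (i mod length u) = a" by (simp add: nth_append)
      with True show ?thesis using walk_hd[OF assms] by (simp add: mod_Suc)
    next
      case False
      with *[of i] show ?thesis by (simp add: nth_append mod_Suc)
    qed
    then show ?thesis
      using walk_nth(2)[OF assms(1) *, of i] by (simp add: periodic_seq_def)
  qed
  then show ?thesis
    using walk_nth(1)[OF assms(1) *] by (simp add: markov_shift_def periodic_seq_def)
qed

text \<open>
  Transitivity applied to \<open>a\<close> and \<open>a\<close> may only give the trivial walk, hence the detour through
  another symbol.
\<close>

lemma nontrivial_loop_exists:
  assumes "transitive_shift M" "1 \<le> a"
  shows "\<exists>u. u \<noteq> [] \<and> walk M a u a"
proof -
  obtain u where u: "walk M a u (Suc a)" using walk_exists[OF assms] by fastforce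
  moreover obtain v where "walk M (Suc a) v a" using walk_exists[OF assms(1) _ assms(2)] by fastforce
  ultimately have "walk M a (u @ v) a" by (auto simp: walk_append)
  moreover have "u \<noteq> []" using u by auto
  ultimately show ?thesis by blast
qed

lemma F_property_iff_finite_loops:
  "F_property M \<longleftrightarrow> (\<forall>a n. finite {u. walk M a u a \<and> length u = n})"
proof -
  have eq: "{w. admissible_word M w \<and> length w = Suc n \<and> hd w = a \<and> last w = a} =
      (\<lambda>u. u @ [a]) ` {u. walk M a u a \<and> length u = n}" (is "?L = ?R") for a n
  proof (intro equalityI subsetI)
    fix w assume w: "w \<in> ?L"
    then have eq: "butlast w @ [a] = w"
      using w by (auto simp: admissible_word_def) (metis append_butlast_last_id)
    with w have "butlast w \<in> {u. walk M a u a \<and> length u = n}"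
      by (simp add: walk_iff_admissible)
    then show "w \<in> ?R" using eq by (metis (no_types, lifting) image_iff)
  qed (auto simp: walk_iff_admissible)
  have fin: "finite {w. admissible_word M w \<and> length w = Suc n \<and> hd w = a \<and> last w = a} \<longleftrightarrow>
      finite {u. walk M a u a \<and> length u = n}" for a n
    unfolding eq by (rule finite_image_iff) (simp add: inj_on_def)
  have zero: "{u. walk M 0 u 0 \<and> length u = n} = {}" for n
    using walk_pos[of M 0] by fastforce
  have "F_property M \<longleftrightarrow> (\<forall>a\<ge>1. \<forall>n. finite {u. walk M a u a \<and> length u = n})"
    unfolding F_property_def fin[symmetric] by (auto simp: le_Suc_ex Suc_le_eq gr0_conv_Suc)
  also have "\<dots> \<longleftrightarrow> (\<forall>a n. finite {u. walk M a u a \<and> length u = n})"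
  proof (intro iffI allI impI)
    fix a n assume *: "\<forall>a\<ge>1. \<forall>n. finite {u. walk M a u a \<and> length u = n}"
    show "finite {u. walk M a u a \<and> length u = n}"
    proof (cases "a = 0")
      case True
      with zero show ?thesis by (metis finite.emptyI)
    qed (use * in simp)
  qed simp
  finally show ?thesis .
qed

text \<open>
  The two ends \<open>a\<close> and \<open>b\<close> need not agree, since a fixed return path from \<open>b\<close> to \<open>a\<close> turns
  the walks into loops of one common length.
\<close>

lemma unbounded_walks_imp_not_F:
  assumes "transitive_shift M" "\<And>N. \<exists>u. walk M a u b \<and> length u = n \<and> (\<exists>z\<in>set u. N \<le> z)"
  shows "\<not> F_property M"
proof
  assume F: "F_property M"
  obtain u where u: "walk M a u b" using assms(2) by blast
  then have "1 \<le> b" by (auto simp: walk_iff_admissible admissible_word_def)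
  then obtain c where c: "walk M b c a"
    using walk_exists[OF assms(1) _ walk_pos[OF u]] by blast
  let ?W = "{u. walk M a u a \<and> length u = n + length c}"
  have "finite (\<Union>(set ` ?W))"
    using F by (auto simp: F_property_iff_finite_loops)
  then obtain N where N: "\<And>z. z \<in> \<Union>(set ` ?W) \<Longrightarrow> z < N"
    unfolding finite_nat_set_iff_bounded by (elim exE) (rule that, erule bspec)
  obtain v z where v: "walk M a v b" "length v = n" and z: "z \<in> set v" "N \<le> z"
    using assms(2)[of N] by auto
  from v c have "v @ c \<in> ?W" by (auto simp: walk_append)
  then have "z \<in> \<Union>(set ` ?W)" using z(1) by force
  then have "z < N" by (rule N)
  with z(2) show False by simp
qed

section \<open>Limits of walks\<close>

text \<open>
  The basic neighbourhoods of a symbol of the extended alphabet: a finite symbol is isolated, and the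
  neighbourhoods of \<open>\<infinity>\<close> consist of the large symbols.
\<close>

definition apx :: "nat \<Rightarrow> enat \<Rightarrow> nat \<Rightarrow> bool" where
  "apx N e k \<longleftrightarrow> e = enat k \<or> e = \<infinity> \<and> N \<le> k"

text \<open>
  A word over the extended alphabet that is a limit of walks between two fixed finite symbols. As the
  ends of the walks are fixed, such words still concatenate.
\<close>

definition ext_walk :: "(nat \<Rightarrow> nat \<Rightarrow> nat) \<Rightarrow> nat \<Rightarrow> enat list \<Rightarrow> nat \<Rightarrow> bool" where
  "ext_walk M a w b \<longleftrightarrow> (\<forall>N. \<exists>u. list_all2 (apx N) w u \<and> walk M a u b)"

lemma ext_walk_append: "ext_walk M a u c \<Longrightarrow> ext_walk M c v b \<Longrightarrow> ext_walk M a (u @ v) b"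
  unfolding ext_walk_def walk_append by (meson list_all2_appendI walk_append)

lemma ext_walk_of_walk: "walk M a u b \<Longrightarrow> ext_walk M a (map enat u) b"
  unfolding ext_walk_def by (auto simp: list_all2_conv_all_nth apx_def intro!: exI[of _ u])

lemma ext_walk_pos: "ext_walk M a u b \<Longrightarrow> 1 \<le> a \<and> 1 \<le> b"
proof -
  assume "ext_walk M a u b"
  then obtain v where "walk M a v b" unfolding ext_walk_def by blast
  then show ?thesis using walk_pos[of M a v b] by (simp add: walk_iff_admissible admissible_word_def)
qed

lemma ext_walk_replicate: "ext_walk M a u a \<Longrightarrow> ext_walk M a (concat (replicate k u)) a"
proof (induction k)
  case 0
  have "walk M a [] a" using ext_walk_pos[OF 0] by simp
  from ext_walk_of_walk[OF this] show ?case by simp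
qed (auto intro: ext_walk_append)

lemma nat_seq_subseq_limit:
  fixes h :: "nat \<Rightarrow> nat"
  shows "\<exists>e r. strict_mono r \<and> (\<forall>N. \<forall>\<^sub>F j in sequentially. apx N e (h (r j)))"
proof (cases "\<exists>m. infinite {j. h j = m}")
  case True
  then obtain m where "infinite {j. h j = m}" ..
  then have "strict_mono (enumerate {j. h j = m})" "\<And>j. h (enumerate {j. h j = m} j) = m"
    using strict_mono_enumerate enumerate_in_set by auto
  then show ?thesis by (intro exI[of _ "enat m"] exI[of _ "enumerate {j. h j = m}"]) (simp add: apx_def)
next
  case False
  have "\<forall>\<^sub>F j in sequentially. N \<le> h j" for N
  proof -
    have "{j. \<not> N \<le> h j} = (\<Union>m<N. {j. h j = m})" by auto
    then have "finite {j. \<not> N \<le> h j}" using False by simp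
    then show ?thesis by (simp add: eventually_cofinite flip: cofinite_eq_sequentially)
  qed
  then show ?thesis by (intro exI[of _ \<infinity>] exI[of _ id]) (simp add: apx_def strict_mono_def)
qed

lemma list_seq_subseq_limit:
  fixes W :: "nat \<Rightarrow> nat list"
  assumes "\<And>j. length (W j) = n"
  shows "\<exists>v r. strict_mono r \<and> (\<forall>N. \<forall>\<^sub>F j in sequentially. list_all2 (apx N) v (W (r j)))"
  using assms
proof (induction n arbitrary: W)
  case 0
  then show ?case by (intro exI[of _ "[]"] exI[of _ id]) (simp add: strict_mono_def)
next
  case (Suc n)
  obtain e r where r: "strict_mono r" "\<And>N. \<forall>\<^sub>F j in sequentially. apx N e (hd (W (r j)))"
    using nat_seq_subseq_limit[of "\<lambda>j. hd (W j)"] by blast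
  obtain v q where q: "strict_mono q"
      "\<And>N. \<forall>\<^sub>F j in sequentially. list_all2 (apx N) v (tl (W (r (q j))))"
    using Suc.IH[of "\<lambda>j. tl (W (r j))"] Suc.prems by auto
  have W: "W j = hd (W j) # tl (W j)" for j using Suc.prems[of j] by (cases "W j") auto
  have "\<forall>\<^sub>F j in sequentially. list_all2 (apx N) (e # v) (W ((r \<circ> q) j))" for N
    using eventually_subseq[OF q(1) r(2)[of N]] q(2)[of N]
    by eventually_elim (subst W, simp)
  then show ?case using r(1) q(1) strict_mono_o by blast
qed

text \<open>
  Infinitely many loops of one length accumulate at a word in which some entry is \<open>\<infinity>\<close>, because words
  of finite symbols are isolated.
\<close>

lemma infinite_ext_loop:
  assumes "\<not> F_property M"
  shows "\<exists>a v. ext_walk M a v a \<and> \<infinity> \<in> set v"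
proof -
  obtain a n where inf: "infinite {u. walk M a u a \<and> length u = n}"
    using assms by (auto simp: F_property_iff_finite_loops)
  then obtain W :: "nat \<Rightarrow> nat list" where W: "inj W" "range W \<subseteq> {u. walk M a u a \<and> length u = n}"
    using infinite_countable_subset by blast
  then have Wj: "walk M a (W j) a" "length (W j) = n" for j by auto
  obtain v r where r: "strict_mono r" "\<And>N. \<forall>\<^sub>F j in sequentially. list_all2 (apx N) v (W (r j))"
    using list_seq_subseq_limit[of W n] Wj by blast
  have "ext_walk M a v a"
    unfolding ext_walk_def
  proof
    fix N
    obtain j where "list_all2 (apx N) v (W (r j))"
      using eventually_happens[OF r(2)] by auto
    then show "\<exists>u. list_all2 (apx N) v u \<and> walk M a u a" using Wj by blast
  qed
  moreover have "\<infinity> \<in> set v"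
  proof (rule ccontr)
    assume v: "\<infinity> \<notin> set v"
    have eq: "u = map the_enat v" if "list_all2 (apx N) v u" for u N
    proof (rule nth_equalityI)
      fix i assume "i < length u"
      then have "apx N (v ! i) (u ! i)" and i: "i < length v"
        using that by (auto simp: list_all2_conv_all_nth)
      moreover have "v ! i \<noteq> \<infinity>" using v nth_mem[OF i] by metis
      ultimately have "apx N (v ! i) (u ! i)" "v ! i \<noteq> \<infinity>" "i < length v"
        using i by auto
      then show "u ! i = map the_enat v ! i" by (auto simp: apx_def)
    qed (use that in \<open>simp add: list_all2_conv_all_nth\<close>)
    obtain J where J: "\<And>j. J \<le> j \<Longrightarrow> list_all2 (apx 0) v (W (r j))"
      using r(2)[of 0] by (auto simp: eventually_sequentially)
    have "W (r J) = W (r (Suc J))" using eq[OF J[of J]] eq[OF J[of "Suc J"]] by simp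
    then show False using W(1) r(1) by (metis injD n_not_Suc_n strict_mono_eq)
  qed
  ultimately show ?thesis by blast
qed

section \<open>Topology of the compactification\<close>

lemma left_shift_funpow: "(left_shift ^^ i) x = (\<lambda>n. x (n + i))"
  by (induction i arbitrary: x) (simp_all add: left_shift_def funpow_swap1)

lemma shift_funpow_compactification:
  "x \<in> compactification M \<Longrightarrow> (left_shift ^^ i) x \<in> compactification M"
  by (induction i) (use shift_compactification in auto)

lemma continuous_map_shift_funpow:
  "continuous_map (compactification_topology M) (compactification_topology M) (left_shift ^^ i)"
proof (induction i)
  case (Suc i)
  from continuous_map_compose[OF this continuous_map_shift] show ?case by (simp add: comp_def)
qed (simp add: id_def)

lemma d_bar_le:
  assumes "\<And>i. i < L \<Longrightarrow> rho_bar (x i) (y i) \<le> \<delta>" "0 \<le> \<delta>"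
  shows "d_bar x y \<le> \<delta> + (1/2) ^ L"
  using assms(1)
proof (induction L arbitrary: x y)
  case 0
  have "d_bar x y \<le> (\<Sum>n. (1/2) ^ Suc n)"
    unfolding d_bar_def
  proof (rule suminf_le[OF _ summable_d_bar])
    show "summable (\<lambda>n. (1/2) ^ Suc n :: real)"
      by (subst summable_Suc_iff) simp
  qed (simp add: rho_bar_bounds)
  also have "\<dots> = 1"
    using suminf_split_head[of "\<lambda>n. (1/2 :: real) ^ n"] by (simp add: suminf_geometric)
  finally show ?case using assms(2) by simp
next
  case (Suc L)
  have "d_bar x y = 1/2 * rho_bar (x 0) (y 0) + (\<Sum>n. (1/2) ^ Suc (Suc n) * rho_bar (x (Suc n)) (y (Suc n)))"
    unfolding d_bar_def using suminf_split_head[OF summable_d_bar[of x y]]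
    by (simp only: power_Suc power_0)
  also have "(\<Sum>n. (1/2) ^ Suc (Suc n) * rho_bar (x (Suc n)) (y (Suc n))) =
      (\<Sum>n. 1/2 * ((1/2) ^ Suc n * rho_bar (left_shift x n) (left_shift y n)))"
    by (simp only: left_shift_def power_Suc mult.assoc)
  also have "\<dots> = 1/2 * d_bar (left_shift x) (left_shift y)"
    unfolding d_bar_def by (rule suminf_mult[OF summable_d_bar])
  finally have "d_bar x y = 1/2 * rho_bar (x 0) (y 0) + 1/2 * d_bar (left_shift x) (left_shift y)" .
  moreover have "rho_bar (x 0) (y 0) \<le> \<delta>" by (rule Suc.prems) simp
  moreover have "d_bar (left_shift x) (left_shift y) \<le> \<delta> + (1/2) ^ L"
    by (rule Suc.IH) (simp add: left_shift_def Suc.prems)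
  ultimately show ?case by simp
qed

lemma recip_le:
  assumes "enat N \<le> a" "1 \<le> N"
  shows "recip a \<le> 1 / real N"
  using assms by (cases a) (auto simp: recip_def frac_le)

lemma rho_bar_le:
  assumes "a = b \<or> enat N \<le> a \<and> enat N \<le> b" "1 \<le> N"
  shows "rho_bar a b \<le> 1 / real N"
proof (cases "a = b")
  case False
  with assms have "recip a \<le> 1 / real N" "recip b \<le> 1 / real N" by (auto intro: recip_le)
  then show ?thesis using recip_bounds(1)[of a] recip_bounds(1)[of b] by (simp add: rho_bar_def abs_le_iff)
qed (simp add: rho_bar_def)

text \<open>
  Agreement of the first \<open>L\<close> coordinates, where all symbols \<open>\<ge> N\<close> (including \<open>\<infinity>\<close>) are identified.
  These relations generate the uniformity of \<open>d_bar\<close>.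
\<close>

definition cylinder_close :: "nat \<Rightarrow> nat \<Rightarrow> (nat \<Rightarrow> enat) \<Rightarrow> (nat \<Rightarrow> enat) \<Rightarrow> bool" where
  "cylinder_close N L x y \<longleftrightarrow> (\<forall>i<L. x i = y i \<or> enat N \<le> x i \<and> enat N \<le> y i)"

lemma cylinder_close_d_bar:
  assumes "0 < \<delta>"
  shows "\<exists>N L. \<forall>x y. cylinder_close N L x y \<longrightarrow> d_bar x y < \<delta>"
proof -
  obtain N where N: "1 / real (Suc N) < \<delta> / 2" using nat_approx_posE[of "\<delta>/2"] assms by auto
  obtain L where L: "(1/2) ^ L < \<delta> / 2" using real_arch_pow_inv[of "\<delta>/2" "1/2"] assms by auto
  have "d_bar x y < \<delta>" if "cylinder_close (Suc N) L x y" for x y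
  proof -
    have "d_bar x y \<le> 1 / real (Suc N) + (1/2) ^ L"
      using that by (intro d_bar_le rho_bar_le) (auto simp: cylinder_close_def)
    with N L show ?thesis by simp
  qed
  then show ?thesis by blast
qed

lemma in_compactificationI:
  assumes "x \<in> ext_sequences"
    and "\<And>N L. \<exists>y\<in>markov_shift M. cylinder_close N L x (embed_seq y)"
  shows "x \<in> compactification M"
proof -
  have "\<exists>y\<in>embed_seq ` markov_shift M. y \<in> ext.mball x r" if r: "0 < r" for r
  proof -
    obtain N L where NL: "\<And>x y. cylinder_close N L x y \<Longrightarrow> d_bar x y < r"
      using cylinder_close_d_bar[OF r] by blast
    obtain y where "y \<in> markov_shift M" "cylinder_close N L x (embed_seq y)" using assms(2) by blast
    moreover from this have "embed_seq y \<in> ext_sequences"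
      using embed_in_compactification compactification_subset by blast
    ultimately show ?thesis using NL assms(1) by (auto simp: ext.in_mball)
  qed
  then show ?thesis
    using assms(1) by (simp add: compactification_def ext_topology_def ext.metric_closure_of)
qed

lemma compactification_approx:
  assumes "x \<in> compactification M"
  shows "\<exists>y\<in>markov_shift M. \<forall>i<L. apx N (x i) (y i)"
proof -
  have xs: "x \<in> ext_sequences" using assms compactification_subset by blast
  define V where "V i = {z \<in> ext_sequences. z i = x i \<or> x i = \<infinity> \<and> enat N \<le> z i}" for i
  have V: "openin ext_topology (V i)" for i
  proof (cases "x i")
    case (enat k)
    have "1 \<le> k" using xs enat by (auto simp: ext_sequences_def one_enat_def dest: spec[of _ i])
    from openin_coordinate_eq[OF this] show ?thesis by (simp add: V_def enat)
  next
    case infinity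
    have "enat N \<le> e \<longleftrightarrow> recip e < 1 / (real N - 1/2)" if "1 \<le> e" "1 \<le> N" for e
      using that by (cases e) (auto simp: recip_def one_enat_def field_simps)
    then have "V i = {z \<in> topspace ext_topology. recip (z i) \<in> (if N = 0 then UNIV else {..<1 / (real N - 1/2)})}"
      by (auto simp: V_def infinity ext_sequences_def recip_def[of \<infinity>] simp flip: zero_enat_def)
    moreover have "open (if N = 0 then UNIV else {..<1 / (real N - 1/2)})" by simp
    ultimately show ?thesis
      by (simp only:) (intro openin_continuous_map_preimage[OF continuous_map_recip], simp)
  qed
  have "openin ext_topology (topspace ext_topology \<inter> \<Inter>(V ` {..<L}))"
    by (intro openin_Int_Inter) (use V openin_topspace[of ext_topology] in auto)
  moreover have "x \<in> topspace ext_topology \<inter> \<Inter>(V ` {..<L})"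
    using xs by (auto simp: V_def)
  ultimately have "\<exists>z. z \<in> embed_seq ` markov_shift M \<and> z \<in> topspace ext_topology \<inter> \<Inter>(V ` {..<L})"
    using assms unfolding compactification_def in_closure_of by meson
  then obtain y where "y \<in> markov_shift M" "\<forall>i<L. embed_seq y \<in> V i"
    by auto
  then show ?thesis by (intro bexI[of _ y]) (auto simp: V_def apx_def embed_seq_def)
qed

lemma compactification_ge_1: "x \<in> compactification M \<Longrightarrow> 1 \<le> x i"
  using compactification_subset by (auto simp: ext_sequences_def)

lemma periodic_seq_compactification:
  assumes "ext_walk M a w a" "w \<noteq> []"
  shows "periodic_seq w \<in> compactification M"
proof (rule in_compactificationI)
  have approx: "\<exists>u. length u = length w \<and> u \<noteq> [] \<and> walk M a u a \<and> (\<forall>i. apx N (periodic_seq w i) (periodic_seq u i))" for N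
  proof -
    obtain u where u: "list_all2 (apx N) w u" "walk M a u a"
      using assms(1) unfolding ext_walk_def by blast
    then have "length u = length w" by (simp add: list_all2_conv_all_nth)
    moreover from this have "u \<noteq> []" using assms(2) by auto
    ultimately show ?thesis using u assms(2)
      by (intro exI[of _ u]) (simp add: periodic_seq_def list_all2_conv_all_nth)
  qed
  show "periodic_seq w \<in> ext_sequences"
    unfolding ext_sequences_def
  proof (intro CollectI allI)
    fix i
    obtain u where "walk M a u a" "u \<noteq> []" and *: "apx 0 (periodic_seq w i) (periodic_seq u i)"
      using approx by blast
    then have "1 \<le> periodic_seq u i"
      using periodic_seq_markov_shift by (auto simp: markov_shift_def)
    with * show "1 \<le> periodic_seq w i" by (auto simp: apx_def one_enat_def)
  qed
  fix N L
  obtain u where "walk M a u a" "u \<noteq> []" "\<And>i. apx N (periodic_seq w i) (periodic_seq u i)"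
    using approx by blast
  then show "\<exists>y\<in>markov_shift M. cylinder_close N L (periodic_seq w) (embed_seq y)"
    by (intro bexI[OF _ periodic_seq_markov_shift]) (force simp: cylinder_close_def embed_seq_def apx_def)+
qed

lemma compact_recip: "compact (recip ` {1..})"
proof -
  have "(\<lambda>n. 1 / real (Suc n)) \<longlonglongrightarrow> 0" by (rule LIMSEQ_Suc) (rule lim_const_over_n)
  moreover have "recip ` {1..} = insert 0 (range (\<lambda>n. 1 / real (Suc n)))"
  proof (intro equalityI subsetI)
    fix t assume "t \<in> recip ` {1..}"
    then obtain e where e: "1 \<le> e" "t = recip e" by auto
    show "t \<in> insert 0 (range (\<lambda>n. 1 / real (Suc n)))"
    proof (cases e)
      case (enat k)
      with e obtain m where "k = Suc m" by (cases k) (auto simp: one_enat_def)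
      with e enat show ?thesis by (auto simp: recip_def)
    qed (use e in \<open>simp add: recip_def\<close>)
  next
    fix t assume "t \<in> insert 0 (range (\<lambda>n. 1 / real (Suc n)))"
    then consider "t = recip \<infinity>" | n where "t = recip (enat (Suc n))" by (auto simp: recip_def)
    then show "t \<in> recip ` {1..}" by cases (auto simp: one_enat_def)
  qed
  ultimately show ?thesis by (simp add: compact_sequence_with_limit)
qed

text \<open>
  The space of all extended sequences is the continuous image, under coordinatewise inversion of
  \<open>recip\<close>, of a countable power of the compact set \<open>recip ` {1..}\<close>.
\<close>

lemma compact_space_ext_topology: "compact_space ext_topology"
proof -
  define P where "P = product_topology (\<lambda>_::nat. top_of_set (recip ` {1..})) UNIV"
  define g where "g y = (\<lambda>n::nat. inv_into {1..} recip (y n))" for y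
  have inj: "inj_on recip {1..}" using recip_inj by (auto simp: inj_on_def)
  have topP: "topspace P = {y. \<forall>n. y n \<in> recip ` {1..}}" by (auto simp: P_def PiE_def Pi_def)
  have rg: "recip (g y n) = y n" if "y \<in> topspace P" for y n
    using that by (auto simp: g_def topP intro: f_inv_into_f)
  have gP: "g y \<in> ext_sequences" if "y \<in> topspace P" for y
    using that inv_into_into[of "y _" recip "{1..}"] by (auto simp: g_def ext_sequences_def topP)
  have "continuous_map P ext_topology g"
    unfolding ext_topology_def ext.continuous_map_to_metric
  proof (intro ballI allI impI)
    fix x and \<epsilon> :: real assume x: "x \<in> topspace P" and \<epsilon>: "0 < \<epsilon>"
    obtain L where L: "(1/2) ^ L < \<epsilon> / 2" using real_arch_pow_inv[of "\<epsilon>/2" "1/2"] \<epsilon> by auto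
    define U where "U = topspace P \<inter> (\<Inter>i<L. {y \<in> topspace P. y i \<in> ball (x i) (\<epsilon>/2)})"
    have "continuous_map P euclideanreal (\<lambda>y. y i)" for i
      using continuous_map_product_projection[of i UNIV "\<lambda>_. top_of_set (recip ` {1..})"]
      unfolding P_def by (rule continuous_map_into_fulltopology) simp
    then have "openin P {y \<in> topspace P. y i \<in> ball (x i) (\<epsilon>/2)}" for i
      by (rule openin_continuous_map_preimage) simp
    then have "openin P U" unfolding U_def by (intro openin_Int_Inter) auto
    moreover have "x \<in> U" using x \<epsilon> by (simp add: U_def)
    moreover have "g y \<in> ext.mball (g x) \<epsilon>" if "y \<in> U" for y
    proof -
      have y: "y \<in> topspace P" using that by (simp add: U_def)
      have "d_bar (g x) (g y) \<le> \<epsilon> / 2 + (1/2) ^ L"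
        using that \<epsilon> by (intro d_bar_le) (force simp: U_def rho_bar_def rg[OF x] rg[OF y] dist_real_def)+
      with L show ?thesis using gP[OF x] gP[OF y] by (simp add: ext.in_mball)
    qed
    ultimately show "\<exists>U. openin P U \<and> x \<in> U \<and> (\<forall>y\<in>U. g y \<in> ext.mball (g x) \<epsilon>)" by blast
  qed
  moreover have "compact_space P"
    unfolding P_def compact_space_product_topology
    using compact_recip by (simp add: compact_space_subtopology)
  ultimately have "compactin ext_topology (g ` topspace P)"
    by (intro image_compactin) (auto simp: compact_space_def)
  moreover have "g ` topspace P = ext_sequences"
  proof (intro equalityI subsetI)
    fix x assume x: "x \<in> ext_sequences"
    then have "x = g (\<lambda>n. recip (x n))"
      by (auto simp: g_def ext_sequences_def inv_into_f_f[OF inj])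
    moreover have "(\<lambda>n. recip (x n)) \<in> topspace P" using x by (auto simp: topP ext_sequences_def)
    ultimately show "x \<in> g ` topspace P" by (rule image_eqI)
  qed (use gP in auto)
  ultimately show ?thesis by (simp add: compact_space_def)
qed

lemma compact_space_compactification: "compact_space (compactification_topology M)"
  unfolding compactification_topology_def compactification_def
  by (intro compact_space_subtopology closedin_compact_space compact_space_ext_topology) simp

lemma continuous_bounded:
  assumes "continuous_map (compactification_topology M) euclideanreal f"
  shows "\<exists>B\<ge>0. \<forall>x\<in>compactification M. \<bar>f x\<bar> \<le> B"
proof -
  have "compactin euclideanreal (f ` compactification M)"
    using image_compactin[OF _ assms, of "compactification M"] compact_space_compactification[of M]
    by (simp add: compact_space_def)
  then have "bounded (f ` compactification M)" by (simp add: compact_imp_bounded)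
  then obtain B where "0 < B" "\<And>x. x \<in> compactification M \<Longrightarrow> \<bar>f x\<bar> \<le> B"
    unfolding bounded_pos by auto
  then show ?thesis by (intro exI[of _ B]) auto
qed

lemma continuous_cylinder_close:
  assumes "continuous_map (compactification_topology M) euclideanreal f" "0 < \<epsilon>"
  shows "\<exists>N L. \<forall>x\<in>compactification M. \<forall>y\<in>compactification M. cylinder_close N L x y \<longrightarrow> \<bar>f x - f y\<bar> \<le> \<epsilon>"
proof -
  define m where "m = submetric (metric (ext_sequences, d_bar)) (compactification M)"
  have top: "mtopology_of m = compactification_topology M"
    by (simp add: m_def mtopology_of_submetric compactification_topology_def ext_topology_def ext.mtopology_of)
  have space: "mspace m = compactification M"
    using compactification_subset by (auto simp: m_def)
  have dist: "mdist m = d_bar" by (simp add: m_def)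
  have "uniformly_continuous_map m euclidean_metric f"
    using continuous_eq_uniformly_continuous_map[of m euclidean_metric f] assms(1)
      compact_space_compactification[of M] by (simp add: top)
  then obtain \<delta> where \<delta>: "0 < \<delta>"
      "\<And>x y. x \<in> compactification M \<Longrightarrow> y \<in> compactification M \<Longrightarrow> d_bar y x < \<delta> \<Longrightarrow> dist (f y) (f x) < \<epsilon>"
    using assms(2) unfolding uniformly_continuous_map_def space dist by force
  obtain N L where NL: "\<And>x y. cylinder_close N L x y \<Longrightarrow> d_bar x y < \<delta>"
    using cylinder_close_d_bar[OF \<delta>(1)] by blast
  show ?thesis
    using \<delta>(2) NL by (intro exI[of _ N] exI[of _ L]) (fastforce simp: dist_real_def)
qed

lemma continuous_le_on_compactification:
  assumes "continuous_map (compactification_topology M) euclideanreal g"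
    and "\<And>y. y \<in> markov_shift M \<Longrightarrow> g (embed_seq y) \<le> c" "x \<in> compactification M"
  shows "g x \<le> c"
proof -
  have "g ` (compactification_topology M closure_of (embed_seq ` markov_shift M)) \<subseteq> {..c}"
    using continuous_map_image_closure_subset[OF assms(1), of "embed_seq ` markov_shift M"] assms(2)
      closure_minimal[of "g ` embed_seq ` markov_shift M" "{..c}"] by (force simp: image_image)
  moreover have "x \<in> compactification_topology M closure_of (embed_seq ` markov_shift M)"
    using assms(3) embed_in_compactification[of M]
    by (simp add: compactification_topology_def closure_of_subtopology Int_absorb1 flip: compactification_def)
  ultimately show ?thesis by auto
qed

section \<open>Averages along loops\<close>

text \<open>
  The sum and the mean of \<open>f\<close> over one period of the periodic point that repeats \<open>w\<close>.
\<close>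

definition loop_sum :: "((nat \<Rightarrow> enat) \<Rightarrow> real) \<Rightarrow> enat list \<Rightarrow> real" where
  "loop_sum f w = (\<Sum>i<length w. f ((left_shift ^^ i) (periodic_seq w)))"

definition loop_average :: "((nat \<Rightarrow> enat) \<Rightarrow> real) \<Rightarrow> enat list \<Rightarrow> real" where
  "loop_average f w = loop_sum f w / real (length w)"

lemma sum_lessThan_add:
  fixes g :: "nat \<Rightarrow> 'a::comm_monoid_add"
  shows "(\<Sum>k<m + n. g k) = (\<Sum>k<m. g k) + (\<Sum>k<n. g (m + k))"
  by (induction n) (simp_all add: add.assoc)

lemma abs_sum_le_exceptional:
  fixes g :: "'a \<Rightarrow> real" and l :: nat and \<epsilon> c :: real
  assumes "finite A" "finite E" "card E \<le> l" "0 \<le> \<epsilon>" "0 \<le> c"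
    and "\<And>k. k \<in> A \<Longrightarrow> k \<notin> E \<Longrightarrow> \<bar>g k\<bar> \<le> \<epsilon>" "\<And>k. k \<in> A \<Longrightarrow> \<bar>g k\<bar> \<le> c"
  shows "\<bar>\<Sum>k\<in>A. g k\<bar> \<le> real (card A) * \<epsilon> + real l * c"
proof -
  have "\<bar>\<Sum>k\<in>A. g k\<bar> \<le> (\<Sum>k\<in>A. \<epsilon> + (if k \<in> E then c else 0))"
    using assms(4-7) by (intro order_trans[OF sum_abs] sum_mono) fastforce
  also have "\<dots> = real (card A) * \<epsilon> + real (card (A \<inter> E)) * c"
    using assms(1) by (simp add: sum.distrib sum.If_cases)
  also have "\<dots> \<le> real (card A) * \<epsilon> + real l * c"
    using assms(2,3,5) card_mono[of E "A \<inter> E"] by (intro add_left_mono mult_right_mono) auto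
  finally show ?thesis .
qed

lemma nth_concat_replicate:
  "i < k * length u \<Longrightarrow> concat (replicate k u) ! i = u ! (i mod length u)"
proof (induction k arbitrary: i)
  case (Suc k)
  then show ?case
    by (cases "i < length u") (auto simp: nth_append mod_if[of i] not_less)
qed simp

lemma length_concat_replicate: "length (concat (replicate k u)) = k * length u"
  by (induction k) auto

lemma periodic_seq_add: "periodic_seq w (length w + i) = periodic_seq w i"
  by (simp add: periodic_seq_def)

lemma funpow_shift_periodic_seq:
  "(left_shift ^^ (length w + i)) (periodic_seq w) = (left_shift ^^ i) (periodic_seq w)"
  unfolding left_shift_funpow
  by (rule ext) (metis add.assoc add.commute periodic_seq_add)

lemma loop_sum_iterate:
  "(\<Sum>k<A * length u. f ((left_shift ^^ k) (periodic_seq u))) = real A * loop_sum f u"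
proof (induction A)
  case (Suc A)
  have "(\<Sum>k<Suc A * length u. f ((left_shift ^^ k) (periodic_seq u))) =
      loop_sum f u + (\<Sum>k<A * length u. f ((left_shift ^^ (length u + k)) (periodic_seq u)))"
    by (simp only: mult_Suc sum_lessThan_add loop_sum_def)
  also have "\<dots> = loop_sum f u + real A * loop_sum f u"
    by (simp only: funpow_shift_periodic_seq Suc)
  finally show ?case by (simp only: of_nat_Suc) (simp add: algebra_simps)
qed simp

lemma card_small_entries:
  assumes "distinct c"
  shows "card {k. k < length c \<and> c ! k < N} \<le> N"
proof -
  have "card {k. k < length c \<and> c ! k < N} = card ((!) c ` {k. k < length c \<and> c ! k < N})"
    using assms by (intro card_image[symmetric]) (auto simp: inj_on_def nth_eq_iff_index_eq)
  also have "\<dots> \<le> card {..<N}" by (intro card_mono) auto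
  finally show ?thesis by simp
qed

lemma card_rotated_indices:
  fixes T :: nat
  shows "card {k. k < T \<and> P ((k + t) mod T)} \<le> card {k. k < T \<and> P k}"
proof -
  have "inj_on (\<lambda>k. (k + t) mod T) {k. k < T}"
  proof (rule linorder_inj_onI)
    fix x y assume "x < y" "y \<in> {k. k < T}"
    then have "0 < y - x" "y - x < T" by auto
    then have "\<not> T dvd (y + t) - (x + t)" by (auto dest: dvd_imp_le)
    then show "(x + t) mod T \<noteq> (y + t) mod T"
      using mod_eq_dvd_iff_nat[of "x + t" "y + t" T] \<open>x < y\<close> by simp
  qed auto
  then have "inj_on (\<lambda>k. (k + t) mod T) {k. k < T \<and> P ((k + t) mod T)}"
    by (rule inj_on_subset) auto
  then show ?thesis
    by (rule card_inj_on_le) auto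
qed

text \<open>
  A function on the compactification that is bounded by \<open>B\<close> and is determined up to \<open>\<epsilon>\<close> by the first
  \<open>L\<close> coordinates with symbols \<open>\<ge> N\<close> identified. Every continuous function is of this kind for
  every \<open>\<epsilon> > 0\<close>.
\<close>

locale local_function =
  fixes M :: "nat \<Rightarrow> nat \<Rightarrow> nat" and f :: "(nat \<Rightarrow> enat) \<Rightarrow> real"
    and N L :: nat and \<epsilon> B :: real
  assumes close: "x \<in> compactification M \<Longrightarrow> y \<in> compactification M \<Longrightarrow> cylinder_close N L x y \<Longrightarrow>
      \<bar>f x - f y\<bar> \<le> \<epsilon>"
    and bound: "x \<in> compactification M \<Longrightarrow> \<bar>f x\<bar> \<le> B"
    and nonneg: "0 \<le> \<epsilon>" "0 \<le> B"
begin

lemma abs_diff_bound: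
  assumes "x \<in> compactification M" "y \<in> compactification M"
  shows "\<bar>f x - f y\<bar> \<le> 2 * B"
  using bound[OF assms(1)] bound[OF assms(2)] by linarith

text \<open>
  Birkhoff sums over two orbit segments with the same itinerary of length \<open>m\<close> are comparable: only
  the last \<open>L\<close> positions see symbols outside the common segment.
\<close>

lemma window:
  assumes "X \<in> compactification M" "Y \<in> compactification M"
    and eq: "\<And>k. k < m \<Longrightarrow> X (i + k) = Y (j + k)"
  shows "\<bar>(\<Sum>k<m. f ((left_shift ^^ (i + k)) X)) - (\<Sum>k<m. f ((left_shift ^^ (j + k)) Y))\<bar>
      \<le> real m * \<epsilon> + 2 * real L * B"
proof -
  let ?g = "\<lambda>k. f ((left_shift ^^ (i + k)) X) - f ((left_shift ^^ (j + k)) Y)"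
  have "\<bar>\<Sum>k<m. ?g k\<bar> \<le> real (card {..<m}) * \<epsilon> + real L * (2 * B)"
  proof (rule abs_sum_le_exceptional)
    show "card {m - L..<m} \<le> L" by simp
    fix k assume "k \<in> {..<m}" "k \<notin> {m - L..<m}"
    then have "\<forall>t<L. k + t < m" by auto
    then have "X (t + (i + k)) = Y (t + (j + k))" if "t < L" for t
      using eq[of "k + t"] that \<open>\<forall>t<L. k + t < m\<close> by (simp add: ac_simps)
    then have "cylinder_close N L ((left_shift ^^ (i + k)) X) ((left_shift ^^ (j + k)) Y)"
      by (simp add: cylinder_close_def left_shift_funpow)
    then show "\<bar>?g k\<bar> \<le> \<epsilon>"
      by (intro close shift_funpow_compactification assms)
  qed (use nonneg assms in \<open>auto intro!: abs_diff_bound shift_funpow_compactification\<close>)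
  then show ?thesis by (simp add: sum_subtractf)
qed

lemma sum_bound:
  assumes "X \<in> compactification M"
  shows "\<bar>\<Sum>k<m. f ((left_shift ^^ (i + k)) X)\<bar> \<le> real m * B"
proof -
  have "\<bar>\<Sum>k<m. f ((left_shift ^^ (i + k)) X)\<bar> \<le> (\<Sum>k<m. B)"
    by (intro order_trans[OF sum_abs] sum_mono bound shift_funpow_compactification assms)
  then show ?thesis by simp
qed

text \<open>
  A loop that runs \<open>p\<close> times through \<open>u\<close> and \<open>q\<close> times through \<open>v\<close>. Apart from
  the term with \<open>\<epsilon>\<close>, the error does not depend on \<open>p\<close> and \<open>q\<close>.
\<close>

lemma splice:
  fixes p q :: nat
  assumes u: "ext_walk M a u a" and c: "ext_walk M a c b" and v: "ext_walk M b v b"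
    and d: "ext_walk M b d a" and ne: "u \<noteq> []" "v \<noteq> []"
  defines "w \<equiv> concat (replicate p u) @ c @ concat (replicate q v) @ d"
  shows "\<bar>loop_sum f w - (real p * loop_sum f u + real q * loop_sum f v)\<bar>
      \<le> real (length w) * \<epsilon> + (4 * real L + real (length c) + real (length d)) * B"
proof (cases "w = []")
  case True
  then have "p = 0" "q = 0" using ne by (auto simp: w_def)
  with True show ?thesis using nonneg by (simp add: loop_sum_def)
next
  case False
  have "ext_walk M a w a"
    unfolding w_def
    by (rule ext_walk_append[OF ext_walk_replicate[OF u]
          ext_walk_append[OF c ext_walk_append[OF ext_walk_replicate[OF v] d]]])
  then have W: "periodic_seq w \<in> compactification M"
    using False by (rule periodic_seq_compactification)
  have U: "periodic_seq u \<in> compactification M" using u ne(1) by (rule periodic_seq_compactification)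
  have V: "periodic_seq v \<in> compactification M" using v ne(2) by (rule periodic_seq_compactification)
  let ?s = "\<lambda>i m. \<Sum>k<m. f ((left_shift ^^ (i + k)) (periodic_seq w))"
  define P Q where "P = p * length u" and "Q = q * length v"
  have len: "length w = P + (length c + (Q + length d))"
    by (simp add: w_def P_def Q_def length_concat_replicate)
  have split: "loop_sum f w = ?s 0 P + (?s P (length c) + (?s (P + length c) Q + ?s (P + length c + Q) (length d)))"
    unfolding loop_sum_def len sum_lessThan_add by (simp add: add.assoc)
  have nth1: "periodic_seq w (0 + k) = periodic_seq u (0 + k)" if "k < P" for k
    using that unfolding periodic_seq_def
    by (simp add: len) (simp add: w_def nth_append nth_concat_replicate length_concat_replicate P_def)
  have 1: "\<bar>?s 0 P - real p * loop_sum f u\<bar> \<le> real P * \<epsilon> + 2 * real L * B"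
    using window[OF W U, of P 0 0] nth1 by (simp add: P_def loop_sum_iterate)
  have nth2: "periodic_seq w (P + length c + k) = periodic_seq v (0 + k)" if "k < Q" for k
    using that unfolding periodic_seq_def
    by (simp add: len) (simp add: w_def nth_append nth_concat_replicate length_concat_replicate P_def Q_def)
  have 2: "\<bar>?s (P + length c) Q - real q * loop_sum f v\<bar> \<le> real Q * \<epsilon> + 2 * real L * B"
    using window[OF W V, of Q "P + length c" 0] nth2 by (simp add: Q_def loop_sum_iterate)
  have 3: "\<bar>?s P (length c)\<bar> \<le> real (length c) * B" "\<bar>?s (P + length c + Q) (length d)\<bar> \<le> real (length d) * B"
    by (rule sum_bound[OF W])+
  have "\<bar>loop_sum f w - (real p * loop_sum f u + real q * loop_sum f v)\<bar> \<le>
      real P * \<epsilon> + real Q * \<epsilon> + (4 * real L + real (length c) + real (length d)) * B"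
    unfolding split using 1 2 3 by (simp add: algebra_simps abs_le_iff)
  also have "real P * \<epsilon> + real Q * \<epsilon> \<le> real (length w) * \<epsilon>"
    using nonneg by (simp add: len algebra_simps)
  finally show ?thesis by simp
qed

text \<open>
  From here on \<open>s\<close> bounds the averages of \<open>f\<close> over all loops of finite symbols. For a
  transitive shift it follows that a Birkhoff sum of length \<open>n\<close> along an orbit in the shift space is at
  most \<open>n * (s + 2 * \<epsilon>)\<close> plus a constant.
\<close>

context
  fixes s :: real
  assumes loops: "\<And>a u. walk M a u a \<Longrightarrow> u \<noteq> [] \<Longrightarrow> loop_average f (map enat u) \<le> s"
begin

lemma loop_sum_le: "walk M a u a \<Longrightarrow> u \<noteq> [] \<Longrightarrow> loop_sum f (map enat u) \<le> real (length u) * s"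
  using loops[of a u] by (simp add: loop_average_def field_simps)

lemma closed_segment_bound:
  assumes x: "x \<in> markov_shift M" and c: "walk M (x (i + m)) c (x i)"
  shows "(\<Sum>k<m. f ((left_shift ^^ (i + k)) (embed_seq x)))
      \<le> real m * (s + \<epsilon>) + (real (length c) * (\<bar>s\<bar> + B) + 2 * real L * B)"
proof (cases "m = 0")
  case True
  then show ?thesis using nonneg by (simp add: mult_nonneg_nonneg)
next
  case False
  define u where "u = map x [i..<i + m] @ c"
  have len: "length u = m + length c" by (simp add: u_def)
  have u: "walk M (x i) u (x i)"
    unfolding u_def walk_append using walk_of_markov_shift[OF x, of i "i + m"] c by auto
  have ne: "u \<noteq> []" using False by (simp add: u_def)
  let ?Y = "periodic_seq (map enat u)"
  have Y: "?Y \<in> compactification M"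
    using periodic_seq_compactification[OF ext_walk_of_walk[OF u]] ne by simp
  have X: "embed_seq x \<in> compactification M" using x embed_in_compactification by blast
  have "embed_seq x (i + k) = ?Y (0 + k)" if "k < m" for k
    using that by (simp add: periodic_seq_def len embed_seq_def) (simp add: u_def nth_append)
  from window[OF X Y, of m i 0, OF this]
  have "(\<Sum>k<m. f ((left_shift ^^ (i + k)) (embed_seq x)))
      \<le> (\<Sum>k<m. f ((left_shift ^^ k) ?Y)) + real m * \<epsilon> + 2 * real L * B" by auto
  moreover have "(\<Sum>k<m. f ((left_shift ^^ k) ?Y)) =
      loop_sum f (map enat u) - (\<Sum>k<length c. f ((left_shift ^^ (m + k)) ?Y))"
    by (simp add: loop_sum_def len sum_lessThan_add)
  moreover have "\<bar>\<Sum>k<length c. f ((left_shift ^^ (m + k)) ?Y)\<bar> \<le> real (length c) * B"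
    by (rule sum_bound[OF Y])
  moreover have "loop_sum f (map enat u) \<le> real (length u) * s" using u ne by (rule loop_sum_le)
  moreover have "real (length c) * s \<le> real (length c) * \<bar>s\<bar>" by (intro mult_left_mono) auto
  ultimately show ?thesis by (simp add: len algebra_simps)
qed

text \<open>
  The symbols at the ends of the segment are arbitrary here, so there is no bound for the length of the
  closing path \<open>c\<close>. Taken without repetition it contains at most \<open>N\<close> symbols below \<open>N\<close>. So
  along the closed-up loop \<open>f\<close> is within \<open>\<epsilon>\<close> of its value \<open>v\<close> at the start of the segment, except at
  no more than \<open>L * N\<close> positions; hence \<open>v\<close> cannot exceed \<open>s\<close> by much if the segment is long. On
  the segment itself \<open>f\<close> is close to \<open>v\<close> as well, except at its last \<open>L\<close> positions.
\<close>

lemma large_segment_bound: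
  assumes tr: "transitive_shift M" and x: "x \<in> markov_shift M"
    and large: "\<And>k. k < m \<Longrightarrow> N \<le> x (i + k)"
  shows "(\<Sum>k<m. f ((left_shift ^^ (i + k)) (embed_seq x)))
      \<le> real m * (s + 2 * \<epsilon>) + (real (L * N) * (2 * B) + 3 * real L * B + real L * \<bar>s\<bar>)"
proof (cases "m \<le> L")
  have X: "embed_seq x \<in> compactification M" using x embed_in_compactification by blast
  case True
  have "(\<Sum>k<m. f ((left_shift ^^ (i + k)) (embed_seq x))) \<le> real m * B"
    using sum_bound[OF X] by (simp add: abs_le_iff)
  also have "\<dots> \<le> real L * B" using True nonneg by (intro mult_right_mono) auto
  finally have 1: "(\<Sum>k<m. f ((left_shift ^^ (i + k)) (embed_seq x))) \<le> real L * B" .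
  have "- (real m * s) \<le> real m * \<bar>s\<bar>" using mult_left_mono[of "-s" "\<bar>s\<bar>" "real m"] by simp
  also have "\<dots> \<le> real L * \<bar>s\<bar>" using True by (intro mult_right_mono) auto
  finally have 2: "- (real m * s) \<le> real L * \<bar>s\<bar>" .
  have "0 \<le> real m * \<epsilon>" "0 \<le> real L * B" "0 \<le> real (L * N) * B" using nonneg by simp_all
  with 1 2 show ?thesis by (simp add: algebra_simps)
next
  have X: "embed_seq x \<in> compactification M" using x embed_in_compactification by blast
  case False
  then have m: "L \<le> m" "0 < m" by auto
  define v where "v = f ((left_shift ^^ i) (embed_seq x))"
  have XL: "enat N \<le> embed_seq x (t + i)" if "t < L" for t
    using large[of t] that m by (simp add: embed_seq_def add.commute)
  have "\<bar>\<Sum>k<m. f ((left_shift ^^ (i + k)) (embed_seq x)) - v\<bar> \<le> real (card {..<m}) * \<epsilon> + real L * (2 * B)"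
  proof (rule abs_sum_le_exceptional)
    show "card {m - L..<m} \<le> L" by simp
    fix k assume "k \<in> {..<m}" "k \<notin> {m - L..<m}"
    then have "N \<le> x (t + (i + k))" if "t < L" for t
      using large[of "t + k"] that by (simp add: ac_simps)
    then have "cylinder_close N L ((left_shift ^^ (i + k)) (embed_seq x)) ((left_shift ^^ i) (embed_seq x))"
      using XL by (auto simp: cylinder_close_def left_shift_funpow embed_seq_def)
    then show "\<bar>f ((left_shift ^^ (i + k)) (embed_seq x)) - v\<bar> \<le> \<epsilon>"
      unfolding v_def by (intro close shift_funpow_compactification X)
  qed (use nonneg X in \<open>auto simp: v_def intro!: abs_diff_bound shift_funpow_compactification\<close>)
  then have 1: "(\<Sum>k<m. f ((left_shift ^^ (i + k)) (embed_seq x))) \<le> real m * v + real m * \<epsilon> + 2 * real L * B"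
    by (simp add: sum_subtractf)
  have "1 \<le> x k" for k using x by (simp add: markov_shift_def)
  then obtain c where c: "walk M (x (i + m)) c (x i)" "distinct c"
    using walk_exists[OF tr] distinct_walk_exists by metis
  define u where "u = map x [i..<i + m] @ c"
  define T where "T = length u"
  have T: "T = m + length c" by (simp add: u_def T_def)
  have u: "walk M (x i) u (x i)"
    unfolding u_def walk_append using walk_of_markov_shift[OF x, of i "i + m"] c by auto
  have ne: "u \<noteq> []" using False by (simp add: u_def)
  let ?Y = "periodic_seq (map enat u)"
  have Y: "?Y \<in> compactification M"
    using periodic_seq_compactification[OF ext_walk_of_walk[OF u]] ne by simp
  have Ynth: "?Y k = enat (u ! (k mod T))" for k
    using ne by (simp add: periodic_seq_def T_def)
  have small: "card {k. k < T \<and> u ! k < N} \<le> N"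
  proof -
    have "{k. k < T \<and> u ! k < N} \<subseteq> (+) m ` {k. k < length c \<and> c ! k < N}"
    proof
      fix k assume k: "k \<in> {k. k < T \<and> u ! k < N}"
      have "m \<le> k" using k large[of k] by (auto simp: u_def nth_append not_less[symmetric])
      then show "k \<in> (+) m ` {k. k < length c \<and> c ! k < N}"
        using k by (intro image_eqI[of _ _ "k - m"]) (auto simp: u_def T_def nth_append)
    qed
    then have "card {k. k < T \<and> u ! k < N} \<le> card ((+) m ` {k. k < length c \<and> c ! k < N})"
      by (intro card_mono) auto
    also have "\<dots> \<le> N" using card_small_entries[OF c(2)] by (simp add: card_image)
    finally show ?thesis .
  qed
  \<comment> \<open>the positions from which a symbol below \<open>N\<close> is visible within \<open>L\<close> coordinates\<close>
  define E where "E = (\<Union>t<L. {k. k < T \<and> u ! ((k + t) mod T) < N})"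
  have "card E \<le> (\<Sum>t<L. card {k. k < T \<and> u ! ((k + t) mod T) < N})"
    unfolding E_def by (intro card_UN_le) simp
  also have "\<dots> \<le> (\<Sum>t<L. N)"
    by (intro sum_mono order_trans[OF card_rotated_indices small])
  finally have E: "card E \<le> L * N" by simp
  have "\<bar>\<Sum>k<T. f ((left_shift ^^ k) ?Y) - v\<bar> \<le> real (card {..<T}) * \<epsilon> + real (L * N) * (2 * B)"
  proof (rule abs_sum_le_exceptional[OF _ _ E])
    show "finite E" by (simp add: E_def)
    fix k assume "k \<in> {..<T}" "k \<notin> E"
    then have "N \<le> u ! ((t + k) mod T)" if "t < L" for t
      using that by (force simp: E_def add.commute not_less[symmetric])
    then have "cylinder_close N L ((left_shift ^^ k) ?Y) ((left_shift ^^ i) (embed_seq x))"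
      using XL by (auto simp: cylinder_close_def left_shift_funpow Ynth)
    then show "\<bar>f ((left_shift ^^ k) ?Y) - v\<bar> \<le> \<epsilon>"
      unfolding v_def by (intro close shift_funpow_compactification X Y)
  qed (use nonneg X Y in \<open>auto simp: v_def intro!: abs_diff_bound shift_funpow_compactification\<close>)
  then have "real T * v - loop_sum f (map enat u) \<le> real T * \<epsilon> + real (L * N) * (2 * B)"
    by (simp add: sum_subtractf loop_sum_def flip: T_def)
  with loop_sum_le[OF u ne] have 2: "real T * (v - s - \<epsilon>) \<le> real (L * N) * (2 * B)"
    by (simp add: algebra_simps flip: T_def)
  have "real m * (v - s - \<epsilon>) \<le> real (L * N) * (2 * B)"
  proof (cases "0 \<le> v - s - \<epsilon>")
    case True
    then have "real m * (v - s - \<epsilon>) \<le> real T * (v - s - \<epsilon>)" by (intro mult_right_mono) (auto simp: T)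
    with 2 show ?thesis by simp
  next
    case False
    then have "real m * (v - s - \<epsilon>) \<le> 0" by (simp add: mult_le_0_iff)
    also have "0 \<le> real (L * N) * (2 * B)" using nonneg by simp
    finally show ?thesis .
  qed
  moreover have "0 \<le> real L * B" using nonneg by simp
  ultimately have "(\<Sum>k<m. f ((left_shift ^^ (i + k)) (embed_seq x)))
      \<le> real m * (s + 2 * \<epsilon>) + (real (L * N) * (2 * B) + 3 * real L * B)"
    using 1 by (simp add: algebra_simps)
  moreover have "0 \<le> real L * \<bar>s\<bar>" by simp
  ultimately show ?thesis by linarith
qed

text \<open>
  An orbit segment is cut at its first and its last symbol below \<open>N\<close>. The middle part is closed up
  by one of finitely many paths between symbols below \<open>N\<close>, so at bounded cost; the two outer parts
  contain only symbols \<open>\<ge> N\<close>.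
\<close>

lemma birkhoff_sum_bound:
  assumes tr: "transitive_shift M"
  shows "\<exists>K. \<forall>x\<in>markov_shift M. \<forall>n.
      (\<Sum>k<n. f ((left_shift ^^ k) (embed_seq x))) \<le> real n * (s + 2 * \<epsilon>) + K"
proof -
  have "\<exists>c. \<forall>a b. 1 \<le> a \<longrightarrow> 1 \<le> b \<longrightarrow> walk M a (c a b) b"
    using walk_exists[OF tr] by metis
  then obtain c where c: "\<And>a b. 1 \<le> a \<Longrightarrow> 1 \<le> b \<Longrightarrow> walk M a (c a b) b" by blast
  define C where "C = Max (insert 0 ((\<lambda>(a, b). length (c a b)) ` ({..<N} \<times> {..<N})))"
  have C: "length (c a b) \<le> C" if "a < N" "b < N" for a b
    unfolding C_def by (rule Max_ge) (use that in auto)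
  define K1 where "K1 = real (L * N) * (2 * B) + 3 * real L * B + real L * \<bar>s\<bar>"
  define K2 where "K2 = real C * (\<bar>s\<bar> + B) + 2 * real L * B"
  have K: "0 \<le> K1" "0 \<le> K2" using nonneg by (auto simp: K1_def K2_def intro!: add_nonneg_nonneg)
  define K where "K = K1 + K2 + (B + \<bar>s\<bar>) + K1"
  show ?thesis
  proof (intro exI[of _ K] ballI allI)
    fix x n assume x: "x \<in> markov_shift M"
    have X: "embed_seq x \<in> compactification M" using x embed_in_compactification by blast
    have x1: "1 \<le> x k" for k using x by (simp add: markov_shift_def)
    let ?s = "\<lambda>i m. \<Sum>k<m. f ((left_shift ^^ (i + k)) (embed_seq x))"
    have "?s 0 n \<le> real n * (s + 2 * \<epsilon>) + K"
    proof (cases "\<exists>k<n. x k < N")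
      case False
      then have "N \<le> x (0 + k)" if "k < n" for k using that by (force simp: not_less[symmetric])
      then have "?s 0 n \<le> real n * (s + 2 * \<epsilon>) + K1"
        unfolding K1_def by (rule large_segment_bound[OF tr x])
      then show ?thesis using K nonneg by (simp add: K_def)
    next
      case True
      let ?A = "{k. k < n \<and> x k < N}"
      define p q where "p = Min ?A" and "q = Max ?A"
      have fin: "finite ?A" "?A \<noteq> {}" using True by auto
      have p: "p \<in> ?A" unfolding p_def using fin by (rule Min_in)
      have q: "q \<in> ?A" unfolding q_def using fin by (rule Max_in)
      have pq: "p \<le> k" "k \<le> q" if "k \<in> ?A" for k
        using that fin by (auto simp: p_def q_def)
      define m r where "m = q - p" and "r = n - Suc q"
      have qm: "q = p + m" using pq(2)[OF p] by (simp add: m_def)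
      have n: "n = p + (m + (1 + r))" using q qm by (simp add: r_def)
      have split: "?s 0 n = ?s 0 p + (?s p m + (?s q 1 + ?s (Suc q) r))"
        unfolding n sum_lessThan_add qm by (simp add: add.assoc)
      have 1: "?s 0 p \<le> real p * (s + 2 * \<epsilon>) + K1"
        unfolding K1_def
      proof (intro large_segment_bound[OF tr x])
        fix k assume "k < p"
        then show "N \<le> x (0 + k)" using p pq(1)[of k] by (cases "x k < N") auto
      qed
      have "?s p m \<le> real m * (s + \<epsilon>) +
          (real (length (c (x (p + m)) (x p))) * (\<bar>s\<bar> + B) + 2 * real L * B)"
        by (intro closed_segment_bound x c x1)
      also have "\<dots> \<le> real m * (s + \<epsilon>) + K2"
        unfolding K2_def using p q nonneg
        by (intro add_left_mono add_right_mono mult_right_mono) (auto simp: qm[symmetric] intro: C)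
      also have "real m * (s + \<epsilon>) \<le> real m * (s + 2 * \<epsilon>)"
        using nonneg by (intro mult_left_mono) auto
      finally have 2: "?s p m \<le> real m * (s + 2 * \<epsilon>) + K2" by simp
      have "?s q 1 \<le> B" using sum_bound[OF X, of q 1] by (simp add: abs_le_iff)
      then have 3: "?s q 1 \<le> (s + 2 * \<epsilon>) + (B + \<bar>s\<bar>)"
        using nonneg(1) abs_ge_minus_self[of s] by linarith
      have 4: "?s (Suc q) r \<le> real r * (s + 2 * \<epsilon>) + K1"
        unfolding K1_def
      proof (intro large_segment_bound[OF tr x])
        fix k assume "k < r"
        then show "N \<le> x (Suc q + k)"
          using pq(2)[of "Suc q + k"] by (force simp: r_def not_less[symmetric])
      qed
      show ?thesis
        unfolding split using 1 2 3 4 by (simp add: n K_def algebra_simps)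
    qed
    then show "(\<Sum>k<n. f ((left_shift ^^ k) (embed_seq x))) \<le> real n * (s + 2 * \<epsilon>) + K" by simp
  qed
qed

end

end

lemma continuous_local_function:
  assumes "continuous_map (compactification_topology M) euclideanreal f" "0 < \<epsilon>"
  shows "\<exists>N L B. local_function M f N L \<epsilon> B"
proof -
  obtain B where "0 \<le> B" "\<forall>x\<in>compactification M. \<bar>f x\<bar> \<le> B"
    using continuous_bounded[OF assms(1)] by blast
  moreover obtain N L where "\<forall>x\<in>compactification M. \<forall>y\<in>compactification M.
      cylinder_close N L x y \<longrightarrow> \<bar>f x - f y\<bar> \<le> \<epsilon>"
    using continuous_cylinder_close[OF assms] by blast
  ultimately show ?thesis
    using assms(2) by (intro exI[of _ N] exI[of _ L] exI[of _ B]) (unfold_locales, auto)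
qed

text \<open>
  The closure of the set of loop averages is convex: the weights \<open>1 - 1 / m\<close> and \<open>1 / m\<close> arise from
  running through \<open>u\<close> and \<open>v\<close> so often that the total lengths spent on them are in ratio
  \<open>m - 1\<close> to \<open>1\<close>.
\<close>

lemma loop_averages_splice:
  assumes "ext_walk M a u a" "ext_walk M a c b" "ext_walk M b v b" "ext_walk M b d a"
    and ne: "u \<noteq> []" "v \<noteq> []" and f: "continuous_map (compactification_topology M) euclideanreal f"
    and m: "1 \<le> m"
  defines "w \<equiv> \<lambda>K. concat (replicate ((m - 1) * length v * K) u) @ c @
      concat (replicate (length u * K) v) @ d"
  shows "(\<lambda>K. loop_average f (w K)) \<longlonglongrightarrow>
      (1 - 1 / real m) * loop_average f u + 1 / real m * loop_average f v"
proof (rule LIMSEQ_I)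
  fix \<eta> :: real assume \<eta>: "0 < \<eta>"
  let ?\<tau> = "(1 - 1 / real m) * loop_average f u + 1 / real m * loop_average f v"
  obtain N L B where "local_function M f N L (\<eta>/2) B"
    using continuous_local_function[OF f, of "\<eta>/2"] \<eta> by auto
  then interpret local_function M f N L "\<eta>/2" B .
  define C where "C = (4 * real L + real (length c) + real (length d)) * B + (real (length c) + real (length d)) * \<bar>?\<tau>\<bar>"
  obtain K0 :: nat where K0: "C / (\<eta> / 2) < real K0" using reals_Archimedean2 by blast
  have lu: "1 \<le> length u" "1 \<le> length v" using ne by (auto simp: Suc_le_eq)
  show "\<exists>no. \<forall>K\<ge>no. norm (loop_average f (w K) - ?\<tau>) < \<eta>"
  proof (intro exI[of _ "Suc K0"] allI impI)
    fix K assume K: "Suc K0 \<le> K"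
    define T where "T = length (w K)"
    have T: "T = m * (length u * length v * K) + (length c + length d)"
      using m unfolding T_def w_def by (cases m) (simp_all add: length_concat_replicate algebra_simps)
    have "1 * K \<le> (m * (length u * length v)) * K"
      using m lu by (intro mult_right_mono) (simp_all add: Suc_le_eq)
    then have "K \<le> m * (length u * length v * K)" by (simp only: mult_1 mult.assoc)
    then have TK: "K \<le> T" unfolding T by linarith
    then have T0: "0 < real T" using K by simp
    have "\<bar>loop_sum f (w K) - (real ((m - 1) * length v * K) * loop_sum f u + real (length u * K) * loop_sum f v)\<bar>
      \<le> real T * (\<eta>/2) + (4 * real L + real (length c) + real (length d)) * B"
      unfolding T_def w_def by (rule splice[OF assms(1-4) ne])
    also have "real ((m - 1) * length v * K) * loop_sum f u + real (length u * K) * loop_sum f v =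
        (real T - real (length c + length d)) * ?\<tau>"
    proof -
      have u: "loop_sum f u = real (length u) * loop_average f u"
        and v: "loop_sum f v = real (length v) * loop_average f v"
        using ne by (simp_all add: loop_average_def)
      show ?thesis unfolding u v T using m by (simp add: of_nat_diff field_simps)
    qed
    finally have "\<bar>loop_sum f (w K) - (real T - real (length c + length d)) * ?\<tau>\<bar> \<le>
        real T * (\<eta>/2) + (4 * real L + real (length c) + real (length d)) * B" .
    moreover have "\<bar>real (length c + length d) * ?\<tau>\<bar> = (real (length c) + real (length d)) * \<bar>?\<tau>\<bar>"
      by (simp only: abs_mult of_nat_add)
    moreover have "loop_sum f (w K) - real T * ?\<tau> =
      (loop_sum f (w K) - (real T - real (length c + length d)) * ?\<tau>) - real (length c + length d) * ?\<tau>"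
      by (simp only: left_diff_distrib)
    moreover have "\<bar>y\<bar> \<le> X + (Y + Z)" if "\<bar>e\<bar> \<le> X + Y" "\<bar>g\<bar> = Z" "y = e - g" for e g y X Y Z :: real
      using that by linarith
    ultimately have "\<bar>loop_sum f (w K) - real T * ?\<tau>\<bar> \<le> real T * (\<eta>/2) + C"
      unfolding C_def by blast
    also have "C < real T * (\<eta> / 2)"
    proof -
      have "C < real K0 * (\<eta> / 2)" using K0 \<eta> by (simp add: field_simps)
      also have "\<dots> \<le> real T * (\<eta> / 2)" using TK K \<eta> by (intro mult_right_mono) auto
      finally show ?thesis .
    qed
    also have "real T * (\<eta>/2) + real T * (\<eta>/2) = \<eta> * real T" by simp
    finally have "\<bar>loop_sum f (w K) - real T * ?\<tau>\<bar> < \<eta> * real T" by simp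
    moreover have "loop_average f (w K) - ?\<tau> = (loop_sum f (w K) - real T * ?\<tau>) / real T"
      using T0 by (simp only: loop_average_def T_def[symmetric] diff_divide_distrib) simp
    ultimately show "norm (loop_average f (w K) - ?\<tau>) < \<eta>"
      by (simp only: real_norm_def abs_divide abs_of_nat pos_divide_less_eq[OF T0])
  qed
qed

section \<open>Invariant measures\<close>

lemma borel_measurable_continuous:
  assumes "continuous_map (compactification_topology M) euclideanreal f"
  shows "f \<in> borel_measurable (compactification_borel M)"
proof (rule borel_measurableI)
  fix S :: "real set" assume "open S"
  then have "openin (compactification_topology M) {x \<in> topspace (compactification_topology M). f x \<in> S}"
    by (intro openin_continuous_map_preimage[OF assms]) simp
  moreover have "f -` S \<inter> space (compactification_borel M) =
      {x \<in> topspace (compactification_topology M). f x \<in> S}" by auto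
  ultimately show "f -` S \<inter> space (compactification_borel M) \<in> sets (compactification_borel M)"
    by (simp add: sets_compactification_borel_openin)
qed

lemma invariant_measuresD:
  assumes "\<mu> \<in> invariant_measures M"
  shows "prob_space \<mu>" "sets \<mu> = sets (compactification_borel M)" "space \<mu> = compactification M"
    "\<And>A. A \<in> sets \<mu> \<Longrightarrow> emeasure \<mu> (left_shift -` A \<inter> space \<mu>) = emeasure \<mu> A"
    "left_shift \<in> \<mu> \<rightarrow>\<^sub>M \<mu>"
proof -
  show s: "sets \<mu> = sets (compactification_borel M)" and "prob_space \<mu>"
    and "\<And>A. A \<in> sets \<mu> \<Longrightarrow> emeasure \<mu> (left_shift -` A \<inter> space \<mu>) = emeasure \<mu> A"
    using assms by (auto simp: invariant_measures_def)
  show "space \<mu> = compactification M" using sets_eq_imp_space_eq[OF s] by simp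
  show "left_shift \<in> \<mu> \<rightarrow>\<^sub>M \<mu>" using measurable_shift measurable_cong_sets[OF s s] by blast
qed

lemma integrable_continuous:
  assumes "\<mu> \<in> invariant_measures M" "continuous_map (compactification_topology M) euclideanreal f"
  shows "integrable \<mu> f"
proof -
  interpret prob_space \<mu> using invariant_measuresD(1)[OF assms(1)] .
  obtain B where "\<forall>x\<in>compactification M. \<bar>f x\<bar> \<le> B"
    using continuous_bounded[OF assms(2)] by blast
  moreover have "f \<in> borel_measurable \<mu>"
    using borel_measurable_continuous[OF assms(2)] measurable_cong_sets[OF invariant_measuresD(2)[OF assms(1)] refl]
    by blast
  ultimately show ?thesis
    by (intro integrable_const_bound[of _ B]) (auto simp: invariant_measuresD(3)[OF assms(1)])
qed

lemma integral_shift: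
  assumes "\<mu> \<in> invariant_measures M" "continuous_map (compactification_topology M) euclideanreal f"
  shows "(\<integral>x. f ((left_shift ^^ i) x) \<partial>\<mu>) = (\<integral>x. f x \<partial>\<mu>)"
proof (induction i)
  case (Suc i)
  note \<mu> = invariant_measuresD[OF assms(1)]
  have "distr \<mu> \<mu> left_shift = \<mu>"
    by (rule measure_eqI) (simp_all add: emeasure_distr[OF \<mu>(5)] \<mu>(4))
  moreover have "(\<lambda>x. f ((left_shift ^^ i) x)) \<in> borel_measurable \<mu>"
    using borel_measurable_continuous[OF continuous_map_compose[OF continuous_map_shift_funpow assms(2)]]
      measurable_cong_sets[OF \<mu>(2) refl] by (auto simp: comp_def)
  ultimately have "(\<integral>x. f ((left_shift ^^ i) (left_shift x)) \<partial>\<mu>) = (\<integral>x. f ((left_shift ^^ i) x) \<partial>\<mu>)"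
    using integral_distr[OF \<mu>(5), of "\<lambda>x. f ((left_shift ^^ i) x)"] by simp
  then show ?case using Suc by (simp add: funpow_swap1)
qed simp

text \<open>
  For a single continuous function the integral against an invariant measure never exceeds the
  supremum of the averages over loops of finite symbols.
\<close>

lemma integral_le_loop_averages:
  assumes tr: "transitive_shift M" and \<mu>: "\<mu> \<in> invariant_measures M"
    and f: "continuous_map (compactification_topology M) euclideanreal f"
    and loops: "\<And>a u. walk M a u a \<Longrightarrow> u \<noteq> [] \<Longrightarrow> loop_average f (map enat u) \<le> s"
  shows "(\<integral>x. f x \<partial>\<mu>) \<le> s"
proof (rule field_le_epsilon)
  fix e :: real assume e: "0 < e"
  interpret prob_space \<mu> using invariant_measuresD(1)[OF \<mu>] .
  obtain N L B where "local_function M f N L (e/2) B"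
    using continuous_local_function[OF f, of "e/2"] e by auto
  then interpret local_function M f N L "e/2" B .
  have "\<exists>K. \<forall>x\<in>markov_shift M. \<forall>n.
      (\<Sum>k<n. f ((left_shift ^^ k) (embed_seq x))) \<le> real n * (s + 2 * (e/2)) + K"
    by (rule birkhoff_sum_bound) (use loops tr in auto)
  then obtain K where K: "\<And>x n. x \<in> markov_shift M \<Longrightarrow>
      (\<Sum>k<n. f ((left_shift ^^ k) (embed_seq x))) \<le> real n * (s + 2 * (e/2)) + K" by blast
  have cont: "continuous_map (compactification_topology M) euclideanreal (\<lambda>x. f ((left_shift ^^ k) x))" for k
    using continuous_map_compose[OF continuous_map_shift_funpow f] by (simp add: comp_def)
  have bound: "real n * ((\<integral>x. f x \<partial>\<mu>) - (s + e)) \<le> K" for n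
  proof -
    have "continuous_map (compactification_topology M) euclideanreal (\<lambda>x. \<Sum>k<n. f ((left_shift ^^ k) x))"
      by (intro continuous_map_sum cont) simp
    from continuous_le_on_compactification[OF this K]
    have le: "(\<Sum>k<n. f ((left_shift ^^ k) x)) \<le> real n * (s + e) + K" if "x \<in> compactification M" for x
      using that by simp
    have int: "integrable \<mu> (\<lambda>x. f ((left_shift ^^ k) x))" for k
      by (rule integrable_continuous[OF \<mu> cont])
    have "real n * (\<integral>x. f x \<partial>\<mu>) = (\<integral>x. (\<Sum>k<n. f ((left_shift ^^ k) x)) \<partial>\<mu>)"
      by (simp add: Bochner_Integration.integral_sum int integral_shift[OF \<mu> f])
    also have "\<dots> \<le> (\<integral>x. real n * (s + e) + K \<partial>\<mu>)"
      by (intro integral_mono Bochner_Integration.integrable_sum int)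
         (auto simp: invariant_measuresD(3)[OF \<mu>] le)
    finally show ?thesis by (simp add: prob_space algebra_simps)
  qed
  show "(\<integral>x. f x \<partial>\<mu>) \<le> s + e"
  proof (rule ccontr)
    assume "\<not> ?thesis"
    then have "0 < (\<integral>x. f x \<partial>\<mu>) - (s + e)" by simp
    from ex_less_of_nat_mult[OF this, of K] bound show False by (auto simp: not_less[symmetric])
  qed
qed

section \<open>Periodic orbit measures\<close>

text \<open>The uniform distribution on the orbit of the periodic point that repeats \<open>w\<close>.\<close>

definition orbit_measure :: "(nat \<Rightarrow> nat \<Rightarrow> nat) \<Rightarrow> enat list \<Rightarrow> (nat \<Rightarrow> enat) measure" where
  "orbit_measure M w = distr (measure_pmf (pmf_of_set {..<length w})) (compactification_borel M)
     (\<lambda>i. (left_shift ^^ i) (periodic_seq w))"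

lemma orbit_measurable:
  assumes "ext_walk M a w a" "w \<noteq> []"
  shows "(\<lambda>i. (left_shift ^^ i) (periodic_seq w)) \<in>
      measure_pmf (pmf_of_set {..<length w}) \<rightarrow>\<^sub>M compactification_borel M"
  using shift_funpow_compactification[OF periodic_seq_compactification[OF assms]] by simp

lemma integral_orbit_measure:
  assumes "ext_walk M a w a" "w \<noteq> []" "continuous_map (compactification_topology M) euclideanreal f"
  shows "(\<integral>x. f x \<partial>orbit_measure M w) = loop_average f w"
proof -
  have ne: "{..<length w} \<noteq> {}" using assms(2) by (simp add: lessThan_empty_iff)
  show ?thesis
    unfolding orbit_measure_def
    by (subst integral_distr[OF orbit_measurable[OF assms(1,2)] borel_measurable_continuous[OF assms(3)]])
       (simp add: integral_pmf_of_set[OF ne] loop_average_def loop_sum_def)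
qed

lemma emeasure_orbit_measure:
  assumes "ext_walk M a w a" "w \<noteq> []" "A \<in> sets (compactification_borel M)"
  shows "emeasure (orbit_measure M w) A =
      ennreal ((\<Sum>i<length w. of_bool ((left_shift ^^ i) (periodic_seq w) \<in> A)) / real (length w))"
proof -
  have ne: "{..<length w} \<noteq> {}" using assms(2) by (simp add: lessThan_empty_iff)
  have "{..<length w} \<inter> (\<lambda>i. (left_shift ^^ i) (periodic_seq w)) -` A =
      {i \<in> {..<length w}. (left_shift ^^ i) (periodic_seq w) \<in> A}" by auto
  then show ?thesis
    unfolding orbit_measure_def
    by (subst emeasure_distr[OF orbit_measurable[OF assms(1,2)] assms(3)])
       (simp add: emeasure_pmf_of_set[OF ne] of_bool_def sum.If_cases Int_def)
qed

lemma orbit_measure_invariant: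
  assumes "ext_walk M a w a" "w \<noteq> []"
  shows "orbit_measure M w \<in> invariant_measures M"
proof -
  let ?O = "orbit_measure M w"
  have sets: "sets ?O = sets (compactification_borel M)" by (simp add: orbit_measure_def)
  have space: "space ?O = compactification M" by (simp add: orbit_measure_def)
  have "prob_space ?O"
    unfolding orbit_measure_def by (intro prob_space.prob_space_distr orbit_measurable[OF assms]) (rule measure_pmf.prob_space_axioms)
  moreover have "emeasure ?O (left_shift -` A \<inter> space ?O) = emeasure ?O A" if A: "A \<in> sets ?O" for A
  proof -
    define g :: "nat \<Rightarrow> real" where "g i = of_bool ((left_shift ^^ i) (periodic_seq w) \<in> A)" for i
    have "g (length w) = g 0" using funpow_shift_periodic_seq[of w 0] by (simp add: g_def)
    then have "(\<Sum>i<length w. g (Suc i)) = (\<Sum>i<length w. g i)"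
      using sum.lessThan_Suc_shift[of g "length w"] sum.lessThan_Suc[of g "length w"] by simp
    moreover have "left_shift -` A \<inter> compactification M \<in> sets (compactification_borel M)"
      using measurable_sets[OF measurable_shift] A sets by fastforce
    ultimately show ?thesis
      using A shift_funpow_compactification[OF periodic_seq_compactification[OF assms]]
      by (simp add: space sets emeasure_orbit_measure[OF assms] g_def)
  qed
  ultimately show ?thesis using sets by (simp add: invariant_measures_def)
qed

lemma orbit_measure_ergodic:
  assumes "ext_walk M a w a" "w \<noteq> []"
  shows "orbit_measure M w \<in> ergodic_measures M"
proof -
  let ?O = "orbit_measure M w" and ?x = "periodic_seq w"
  have "emeasure ?O A = 0 \<or> emeasure ?O A = 1"
    if A: "A \<in> sets ?O" and inv: "left_shift -` A \<inter> space ?O = A" for A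
  proof -
    have A': "A \<in> sets (compactification_borel M)" using A by (simp add: orbit_measure_def)
    have mem: "(left_shift ^^ i) ?x \<in> compactification M" for i
      by (intro shift_funpow_compactification periodic_seq_compactification[OF assms])
    have "x \<in> A \<longleftrightarrow> left_shift x \<in> A" if "x \<in> compactification M" for x
      using inv that by (auto simp: orbit_measure_def)
    from this[OF mem] have "(left_shift ^^ i) ?x \<in> A \<longleftrightarrow> ?x \<in> A" for i
      by (induction i) simp_all
    then show ?thesis
      using assms(2) by (simp add: emeasure_orbit_measure[OF assms A'])
  qed
  then show ?thesis using orbit_measure_invariant[OF assms] by (simp add: ergodic_measures_def)
qed

lemma orbit_measure_not_on_shift:
  assumes "ext_walk M a w a" "\<infinity> \<in> set w"
  shows "orbit_measure M w \<notin> invariant_measures_shift M"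
proof
  assume "orbit_measure M w \<in> invariant_measures_shift M"
  then have 1: "emeasure (orbit_measure M w) (embed_seq ` markov_shift M) = 1"
    by (simp add: invariant_measures_shift_def)
  have ne: "w \<noteq> []" using assms(2) by auto
  obtain j where "j < length w" "w ! j = \<infinity>" using assms(2) by (auto simp: in_set_conv_nth)
  then have "periodic_seq w j = \<infinity>" by (simp add: periodic_seq_def)
  then have "periodic_seq w \<notin> embed_seq ` markov_shift M" by (auto simp: embed_markov_shift_eq)
  then have "(\<Sum>i<length w. of_bool ((left_shift ^^ i) (periodic_seq w) \<in> embed_seq ` markov_shift M)) <
      (\<Sum>i<length w. 1 :: real)"
    using ne by (intro sum_strict_mono_ex1 ballI bexI[of _ 0]) auto
  then have "emeasure (orbit_measure M w) (embed_seq ` markov_shift M) < 1"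
    using ne unfolding emeasure_orbit_measure[OF assms(1) ne embed_markov_shift_measurable]
    by (simp add: ennreal_less_iff[where r = _ and q = 1, simplified] sum_nonneg)
  with 1 show False by simp
qed

section \<open>Density of periodic orbits through infinity\<close>

lemma loop_average_linear:
  "loop_average (\<lambda>x. \<Sum>f\<in>F. c f * f x) w = (\<Sum>f\<in>F. c f * loop_average f w)"
  unfolding loop_average_def loop_sum_def
  by (subst sum.swap) (simp add: sum_distrib_left sum_divide_distrib)

lemma abs_loop_average_le:
  assumes "ext_walk M a w a" "w \<noteq> []" "\<And>x. x \<in> compactification M \<Longrightarrow> \<bar>f x\<bar> \<le> B"
  shows "\<bar>loop_average f w\<bar> \<le> B"
proof -
  have "\<bar>loop_sum f w\<bar> \<le> (\<Sum>i<length w. B)"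
    unfolding loop_sum_def
    by (intro order_trans[OF sum_abs] sum_mono assms(3) shift_funpow_compactification
        periodic_seq_compactification[OF assms(1,2)])
  then show ?thesis using assms(2) by (simp add: loop_average_def divide_le_eq mult.commute)
qed

text \<open>
  Let \<open>D w\<close> be the squared distance between the vectors of loop averages and of integrals of the
  functions in \<open>F\<close>. If the infimum \<open>D0\<close> of \<open>D\<close> over the loops \<open>w\<close> through \<open>\<infinity>\<close> were positive, a
  gradient step would decrease it: the bound \<open>integral_le_loop_averages\<close>, applied to the linear
  combination \<open>h\<close> of \<open>F\<close> in the direction from a nearly optimal \<open>w\<close> to the integrals, gives a loop
  \<open>v\<close> that makes progress in this direction, and splicing a small proportion of \<open>v\<close> into \<open>w\<close> gives
  again a loop through \<open>\<infinity>\<close>. This replaces the separation of a point from a closed convex set.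
\<close>

lemma loops_through_infinity_approximate:
  assumes tr: "transitive_shift M" and nF: "\<not> F_property M" and \<mu>: "\<mu> \<in> invariant_measures M"
    and F: "finite F" and cont: "\<And>f. f \<in> F \<Longrightarrow> continuous_map (compactification_topology M) euclideanreal f"
    and e: "0 < e"
  shows "\<exists>a w. ext_walk M a w a \<and> \<infinity> \<in> set w \<and> (\<forall>f\<in>F. \<bar>loop_average f w - (\<integral>x. f x \<partial>\<mu>)\<bar> < e)"
proof -
  define G where "G = {w. (\<exists>a. ext_walk M a w a) \<and> \<infinity> \<in> set w}"
  define p where "p f = (\<integral>x. f x \<partial>\<mu>)" for f :: "(nat \<Rightarrow> enat) \<Rightarrow> real"
  define D where "D w = (\<Sum>f\<in>F. (loop_average f w - p f)\<^sup>2)" for w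
  define D0 where "D0 = Inf (D ` G)"
  have Gne: "D ` G \<noteq> {}" using infinite_ext_loop[OF nF] by (auto simp: G_def)
  have bdd: "bdd_below (D ` G)" by (rule bdd_belowI[of _ 0]) (auto simp: D_def intro: sum_nonneg)
  have D0: "D0 \<le> D w" if "w \<in> G" for w unfolding D0_def by (intro cInf_lower bdd imageI that)
  have "\<exists>B. \<forall>f\<in>F. \<forall>x\<in>compactification M. \<bar>f x\<bar> \<le> B f"
    using continuous_bounded[OF cont] by (intro bchoice) blast
  then obtain B where B: "\<And>f x. f \<in> F \<Longrightarrow> x \<in> compactification M \<Longrightarrow> \<bar>f x\<bar> \<le> B f" by blast
  \<comment> \<open>bounds the squared distance between any two vectors of loop averages\<close>
  define R where "R = (\<Sum>f\<in>F. (2 * B f)\<^sup>2)"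
  \<comment> \<open>with \<open>2 \<le> m\<close> the spliced loop still contains \<open>w\<close>, and with it the entry \<open>\<infinity>\<close>\<close>
  have step: "D0 \<le> D w + 2 * (1 / real m) * (\<eta> - D w) + (1 / real m)\<^sup>2 * R"
    if w: "w \<in> G" and \<eta>: "0 < \<eta>" and m: "2 \<le> m" for w \<eta> and m :: nat
  proof -
    obtain a where a: "ext_walk M a w a" and inf: "\<infinity> \<in> set w" using w by (auto simp: G_def)
    have ne: "w \<noteq> []" using inf by auto
    define y where "y f = loop_average f w" for f
    define h where "h x = (\<Sum>f\<in>F. (p f - y f) * f x)" for x
    have h: "continuous_map (compactification_topology M) euclideanreal h"
      unfolding h_def
      by (intro continuous_map_sum F) (use cont in \<open>auto intro!: continuous_map_real_mult_left\<close>)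
    have "(\<integral>x. h x \<partial>\<mu>) = (\<Sum>f\<in>F. (p f - y f) * p f)"
      unfolding h_def p_def using integrable_continuous[OF \<mu> cont]
      by (subst Bochner_Integration.integral_sum) auto
    moreover have "\<not> (\<integral>x. h x \<partial>\<mu>) \<le> (\<integral>x. h x \<partial>\<mu>) - \<eta>" using \<eta> by simp
    then obtain b v where b: "walk M b v b" "v \<noteq> []"
        "\<not> loop_average h (map enat v) \<le> (\<integral>x. h x \<partial>\<mu>) - \<eta>"
      using integral_le_loop_averages[OF tr \<mu> h] by blast
    define z where "z f = loop_average f (map enat v)" for f
    have "loop_average h (map enat v) = (\<Sum>f\<in>F. (p f - y f) * z f)"
      unfolding h_def z_def by (rule loop_average_linear)
    ultimately have gain: "(\<Sum>f\<in>F. (p f - y f) * (z f - p f)) > - \<eta>"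
      using b(3) by (simp add: right_diff_distrib sum_subtractf)
    have v: "ext_walk M b (map enat v) b" "map enat v \<noteq> []" using ext_walk_of_walk[OF b(1)] b(2) by auto
    obtain c where c: "walk M a c b"
      using walk_exists[OF tr] ext_walk_pos[OF a] ext_walk_pos[OF v(1)] by blast
    obtain d where d: "walk M b d a"
      using walk_exists[OF tr] ext_walk_pos[OF a] ext_walk_pos[OF v(1)] by blast
    let ?w = "\<lambda>K. concat (replicate ((m - 1) * length (map enat v) * K) w) @ map enat c @
      concat (replicate (length w * K) (map enat v)) @ map enat d"
    have wG: "?w K \<in> G" if "1 \<le> K" for K
    proof -
      have "ext_walk M a (?w K) a"
        by (rule ext_walk_append[OF ext_walk_replicate[OF a] ext_walk_append[OF ext_walk_of_walk[OF c]
            ext_walk_append[OF ext_walk_replicate[OF v(1)] ext_walk_of_walk[OF d]]]])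
      moreover have "(m - 1) * length (map enat v) * K \<noteq> 0" using m b(2) that by simp
      then have "\<infinity> \<in> set (?w K)" using inf by simp
      ultimately show ?thesis by (auto simp: G_def)
    qed
    let ?t = "1 / real m"
    have lim: "(\<lambda>K. loop_average f (?w K)) \<longlonglongrightarrow> (1 - ?t) * y f + ?t * z f" if "f \<in> F" for f
      unfolding y_def z_def
      using m by (intro loop_averages_splice[OF a ext_walk_of_walk[OF c] v(1) ext_walk_of_walk[OF d] ne v(2) cont[OF that]]) simp
    have "(\<lambda>K. D (?w K)) \<longlonglongrightarrow> (\<Sum>f\<in>F. ((1 - ?t) * y f + ?t * z f - p f)\<^sup>2)"
      unfolding D_def by (intro tendsto_sum tendsto_power tendsto_diff lim tendsto_const)
    then have "D0 \<le> (\<Sum>f\<in>F. ((1 - ?t) * y f + ?t * z f - p f)\<^sup>2)"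
      by (rule LIMSEQ_le_const) (use D0[OF wG] in blast)
    also have "\<dots> = (\<Sum>f\<in>F. (y f - p f)\<^sup>2 + 2 * ?t * (- ((p f - y f) * (z f - p f)) - (y f - p f)\<^sup>2)
        + ?t\<^sup>2 * (z f - y f)\<^sup>2)"
      by (intro sum.cong refl) (simp add: power2_eq_square algebra_simps)
    also have "\<dots> = D w + 2 * ?t * (- (\<Sum>f\<in>F. (p f - y f) * (z f - p f)) - D w) + ?t\<^sup>2 * (\<Sum>f\<in>F. (z f - y f)\<^sup>2)"
      by (simp only: D_def y_def[symmetric] sum.distrib sum_subtractf sum_negf sum_distrib_left[symmetric])
    also have "\<dots> \<le> D w + 2 * ?t * (\<eta> - D w) + ?t\<^sup>2 * R"
    proof (intro add_mono mult_left_mono order_refl)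
      show "- (\<Sum>f\<in>F. (p f - y f) * (z f - p f)) - D w \<le> \<eta> - D w" using gain by simp
      show "(\<Sum>f\<in>F. (z f - y f)\<^sup>2) \<le> R"
        unfolding R_def
      proof (intro sum_mono)
        fix f assume f: "f \<in> F"
        have "\<bar>y f\<bar> \<le> B f" "\<bar>z f\<bar> \<le> B f"
          unfolding y_def z_def using B[OF f]
          by (auto intro: abs_loop_average_le[OF a ne] abs_loop_average_le[OF v])
        then have "\<bar>z f - y f\<bar> \<le> 2 * B f" by linarith
        then show "(z f - y f)\<^sup>2 \<le> (2 * B f)\<^sup>2" by (metis abs_ge_zero power2_abs power_mono)
      qed
    qed auto
    finally show ?thesis .
  qed
  have D0_le: "2 * D0 \<le> (1 / real m) * R" if m: "2 \<le> m" for m :: nat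
  proof -
    have "2 * (1 / real m) * D0 \<le> (1 / real m)\<^sup>2 * R + \<epsilon>" if \<epsilon>: "0 < \<epsilon>" for \<epsilon>
    proof -
      let ?t = "1 / real m"
      have t: "0 \<le> ?t" by simp
      define \<eta> where "\<eta> = \<epsilon> / (1 + 2 * ?t)"
      have pos: "0 < 1 + 2 * ?t" by (intro add_pos_nonneg) auto
      have \<eta>: "0 < \<eta>" "\<eta> * (1 + 2 * ?t) = \<epsilon>"
        unfolding \<eta>_def using pos by (rule divide_pos_pos[OF \<epsilon>]) (use less_imp_neq[OF pos] in simp)
      obtain w where w: "w \<in> G" "D w < D0 + \<eta>"
        using cInf_lessD[OF Gne, of "D0 + \<eta>"] \<eta>(1) by (auto simp: D0_def)
      have "2 * ?t * (\<eta> - D w) \<le> 2 * ?t * (\<eta> - D0)"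
        using D0[OF w(1)] t by (intro mult_left_mono) auto
      with step[OF w(1) \<eta>(1) m] w(2) have "D0 \<le> D0 + \<eta> + 2 * ?t * (\<eta> - D0) + ?t\<^sup>2 * R" by linarith
      also have "\<dots> = D0 + \<eta> * (1 + 2 * ?t) - 2 * ?t * D0 + ?t\<^sup>2 * R"
        by (simp only: algebra_simps)
      finally show ?thesis unfolding \<eta>(2) by linarith
    qed
    then have "2 * (1 / real m) * D0 \<le> (1 / real m)\<^sup>2 * R" by (rule field_le_epsilon)
    then have "(1 / real m) * (2 * D0) \<le> (1 / real m) * ((1 / real m) * R)" by (simp add: power2_eq_square algebra_simps)
    then show ?thesis by (rule mult_left_le_imp_le) (use m in simp)
  qed
  have "D0 \<le> 0"
  proof (rule ccontr)
    assume "\<not> D0 \<le> 0"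
    then have "0 < 2 * D0" by simp
    from ex_less_of_nat_mult[OF this, of R] obtain n where n: "R < real n * (2 * D0)" by auto
    have "real n * (2 * D0) \<le> real (n + 2) * (2 * D0)" using \<open>0 < 2 * D0\<close> by (intro mult_right_mono) auto
    moreover have "real (n + 2) * (2 * D0) \<le> real (n + 2) * (1 / real (n + 2) * R)"
      by (intro mult_left_mono D0_le) auto
    moreover have "real (n + 2) * (1 / real (n + 2) * R) = R" by simp
    ultimately show False using n by linarith
  qed
  also have "0 < e\<^sup>2" using e by simp
  finally have "Inf (D ` G) < e\<^sup>2" by (simp add: D0_def)
  from cInf_lessD[OF Gne this] obtain w where w: "w \<in> G" "D w < e\<^sup>2"
    by auto
  have "\<bar>loop_average f w - p f\<bar> < e" if "f \<in> F" for f
  proof -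
    have "(loop_average f w - p f)\<^sup>2 \<le> D w"
      unfolding D_def by (rule member_le_sum[OF that _ F]) simp
    then have "\<bar>loop_average f w - p f\<bar>\<^sup>2 < e\<^sup>2" using w(2) by simp
    then show ?thesis by (rule power_less_imp_less_base) (use e in simp)
  qed
  with w(1) show ?thesis by (auto simp: G_def p_def)
qed

text \<open>The basic weak* neighbourhoods of \<open>\<mu>\<close>, with a common radius for all functions in \<open>F\<close>.\<close>

definition weak_star_ball :: "(nat \<Rightarrow> nat \<Rightarrow> nat) \<Rightarrow> (nat \<Rightarrow> enat) measure \<Rightarrow>
    ((nat \<Rightarrow> enat) \<Rightarrow> real) set \<Rightarrow> real \<Rightarrow> (nat \<Rightarrow> enat) measure set" where
  "weak_star_ball M \<mu> F e =
     {\<nu> \<in> invariant_measures M. \<forall>f\<in>F. \<bar>(\<integral>x. f x \<partial>\<nu>) - (\<integral>x. f x \<partial>\<mu>)\<bar> < e}"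

lemma weak_star_neighbourhood:
  assumes "openin (weak_star_topology M) T" "\<mu> \<in> T"
  shows "\<exists>F e. finite F \<and> 0 < e \<and> (\<forall>f\<in>F. continuous_map (compactification_topology M) euclideanreal f) \<and>
      weak_star_ball M \<mu> F e \<subseteq> T"
  using assms unfolding weak_star_topology_def openin_topology_generated_by_iff
proof (induction T rule: generate_topology_on.induct)
  case Empty
  then show ?case by simp
next
  case (Int A B)
  from Int.IH(1) Int.prems obtain F e where F: "finite F" "0 < e"
      "\<forall>f\<in>F. continuous_map (compactification_topology M) euclideanreal f" "weak_star_ball M \<mu> F e \<subseteq> A"
    by blast
  from Int.IH(2) Int.prems obtain G d where G: "finite G" "0 < d"
      "\<forall>f\<in>G. continuous_map (compactification_topology M) euclideanreal f" "weak_star_ball M \<mu> G d \<subseteq> B"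
    by blast
  have "weak_star_ball M \<mu> (F \<union> G) (min e d) \<subseteq> weak_star_ball M \<mu> F e \<inter> weak_star_ball M \<mu> G d"
    by (auto simp: weak_star_ball_def)
  with F G show ?case by (intro exI[of _ "F \<union> G"] exI[of _ "min e d"]) auto
next
  case (UN K)
  then obtain k where k: "k \<in> K" "\<mu> \<in> k" by blast
  from UN.IH[OF this] k(1) show ?case by blast
next
  case (Basis T)
  then obtain f U where f: "continuous_map (compactification_topology M) euclideanreal f" "open U"
    and T: "T = {\<mu> \<in> invariant_measures M. (\<integral>x. f x \<partial>\<mu>) \<in> U}" by blast
  with Basis.prems obtain e where "0 < e" "\<And>y. dist y (\<integral>x. f x \<partial>\<mu>) < e \<Longrightarrow> y \<in> U"
    unfolding open_dist by blast
  with f show ?case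
    unfolding T by (intro exI[of _ "{f}"] exI[of _ e]) (auto simp: weak_star_ball_def dist_real_def)
qed

lemma dense_of_not_F:
  assumes "transitive_shift M" "\<not> F_property M"
  shows "weak_star_topology M closure_of
      (ergodic_measures M \<inter> (invariant_measures M - invariant_measures_shift M)) = invariant_measures M"
proof (intro equalityI subsetI)
  fix \<mu> assume \<mu>: "\<mu> \<in> invariant_measures M"
  show "\<mu> \<in> weak_star_topology M closure_of
      (ergodic_measures M \<inter> (invariant_measures M - invariant_measures_shift M))"
    unfolding in_closure_of
  proof (intro conjI allI impI)
    fix T assume "\<mu> \<in> T \<and> openin (weak_star_topology M) T"
    then obtain F e where F: "finite F" "0 < e"
        "\<forall>f\<in>F. continuous_map (compactification_topology M) euclideanreal f"
        "weak_star_ball M \<mu> F e \<subseteq> T"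
      using weak_star_neighbourhood[of M T \<mu>] by blast
    then obtain a w where w: "ext_walk M a w a" "\<infinity> \<in> set w"
        "\<And>f. f \<in> F \<Longrightarrow> \<bar>loop_average f w - (\<integral>x. f x \<partial>\<mu>)\<bar> < e"
      using loops_through_infinity_approximate[OF assms \<mu>, of F e] by blast
    have ne: "w \<noteq> []" using w(2) by auto
    have "orbit_measure M w \<in> weak_star_ball M \<mu> F e"
      using F(3) w(3) orbit_measure_invariant[OF w(1) ne]
      by (simp add: weak_star_ball_def integral_orbit_measure[OF w(1) ne])
    with F(4) have "orbit_measure M w \<in> T" by blast
    then show "\<exists>\<nu>. \<nu> \<in> ergodic_measures M \<inter> (invariant_measures M - invariant_measures_shift M) \<and> \<nu> \<in> T"
      using orbit_measure_ergodic[OF w(1) ne] orbit_measure_invariant[OF w(1) ne]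
        orbit_measure_not_on_shift[OF w(1,2)] by blast
  qed (simp add: \<mu>)
qed (use closure_of_subset_topspace[of "weak_star_topology M"] in auto)

text \<open>
  The integral of \<open>recip (x 0)\<close> vanishes at \<open>dirac_infinity M\<close> and is positive on periodic orbits in
  the shift space.
\<close>

lemma closure_dirac_infinity:
  assumes "transitive_shift M"
  shows "weak_star_topology M closure_of {dirac_infinity M} \<noteq> invariant_measures M"
proof
  assume eq: "weak_star_topology M closure_of {dirac_infinity M} = invariant_measures M"
  obtain u where u: "u \<noteq> []" "walk M 1 u 1" using nontrivial_loop_exists[OF assms, of 1] by auto
  let ?w = "map enat u" and ?f = "\<lambda>x :: nat \<Rightarrow> enat. recip (x 0)"
  have w: "ext_walk M 1 ?w 1" "?w \<noteq> []" using ext_walk_of_walk[OF u(2)] u(1) by auto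
  have f: "continuous_map (compactification_topology M) euclideanreal ?f"
    unfolding compactification_topology_def by (intro continuous_map_from_subtopology continuous_map_recip)
  define T where "T = {\<mu> \<in> invariant_measures M. (\<integral>x. ?f x \<partial>\<mu>) \<in> {0<..}}"
  have T: "openin (weak_star_topology M) T"
    unfolding weak_star_topology_def T_def by (intro topology_generated_by_Basis CollectI exI[of _ ?f] exI[of _ "{0<..}"])
       (simp add: f)
  have "0 < recip (enat (u ! i))" if "i < length u" for i
    using walk_nth(1)[OF u(2) that] by (simp add: recip_def)
  then have "0 < loop_average ?f ?w"
    unfolding loop_average_def loop_sum_def using u(1)
    by (intro divide_pos_pos sum_pos) (auto simp: left_shift_funpow periodic_seq_def)
  then have "orbit_measure M ?w \<in> T"
    using orbit_measure_invariant[OF w] by (simp add: T_def integral_orbit_measure[OF w f])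
  moreover have "orbit_measure M ?w \<in> weak_star_topology M closure_of {dirac_infinity M}"
    using eq orbit_measure_invariant[OF w] by simp
  ultimately have *: "dirac_infinity M \<in> T"
    using T unfolding in_closure_of by auto
  then have "(\<lambda>_. \<infinity>) \<in> compactification M" by (simp add: T_def dirac_infinity_invariant)
  then have "(\<integral>x. ?f x \<partial>dirac_infinity M) = 0"
    unfolding dirac_infinity_def by (subst integral_return) (auto simp: borel_measurable_continuous[OF f], simp add: recip_def)
  with * show False by (simp add: T_def)
qed

section \<open>Measures outside the shift space under the F-property\<close>

lemma markov_shift_shift: "x \<in> markov_shift M \<Longrightarrow> (\<lambda>n. x (n + i)) \<in> markov_shift M"
  by (simp add: markov_shift_def)

lemma infinity_between_finite_imp_not_F:
  assumes "transitive_shift M" "x \<in> compactification M" "i < k" "k < j"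
    "x i \<noteq> \<infinity>" "x k = \<infinity>" "x j \<noteq> \<infinity>"
  shows "\<not> F_property M"
proof -
  obtain a b where a: "x i = enat a" and b: "x j = enat b" using assms by auto
  have "\<exists>u. walk M a u b \<and> length u = j - i \<and> (\<exists>z\<in>set u. N \<le> z)" for N
  proof -
    obtain y where y: "y \<in> markov_shift M" "\<And>l. l < Suc j \<Longrightarrow> apx N (x l) (y l)"
      using compactification_approx[OF assms(2), of "Suc j" N] by blast
    have "y i = a" "y j = b" "N \<le> y k"
      using y(2)[of i] y(2)[of j] y(2)[of k] a b assms by (auto simp: apx_def)
    then show ?thesis
      using walk_of_markov_shift[OF y(1), of i j] assms
      by (intro exI[of _ "map y [i..<j]"]) auto
  qed
  then show ?thesis by (rule unbounded_walks_imp_not_F[OF assms(1)])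
qed

text \<open>
  Otherwise, for some \<open>N\<close> and \<open>L\<close>, every point of the shift space meets a symbol below \<open>N\<close> in every
  window of length \<open>L\<close>. Then each large symbol lies on a walk of length below \<open>2 * L\<close> between two
  symbols below \<open>N\<close>; as there are finitely many choices of the ends and of the length, the F-property fails.
\<close>

lemma infinity_in_compactification:
  assumes tr: "transitive_shift M" and F: "F_property M"
  shows "(\<lambda>_. \<infinity>) \<in> compactification M"
proof (rule in_compactificationI)
  fix N L
  have "\<exists>y\<in>markov_shift M. \<forall>i<L. N \<le> y i"
  proof (rule ccontr)
    assume "\<not> ?thesis"
    then have small: "\<exists>i<L. y i < N" if "y \<in> markov_shift M" for y using that by (auto simp: not_le)
    \<comment> \<open>\<open>Q K (a, b, n)\<close>: some walk of length \<open>n\<close> from \<open>a\<close> to \<open>b\<close> contains a symbol that is at least \<open>K\<close>\<close>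
    define Q where "Q K q = (case q of (a, b, n) \<Rightarrow>
        \<exists>u. walk M a u b \<and> length u = n \<and> (\<exists>z\<in>set u. K \<le> z))" for K :: nat and q :: "nat \<times> nat \<times> nat"
    let ?I = "{..<N} \<times> {..<N} \<times> {..<2 * L}"
    have Q: "\<exists>q\<in>?I. Q K q" for K
    proof -
      \<comment> \<open>the symbol \<open>Suc (K + N)\<close> is at least \<open>K\<close>, and it is not one of the symbols below \<open>N\<close>\<close>
      obtain u where u: "walk M 1 u (Suc (K + N))" using walk_exists[OF tr, of 1 "Suc (K + N)"] by auto
      obtain v where v: "walk M (Suc (K + N)) v 1" "v \<noteq> []"
      proof -
        obtain v' where "walk M (Suc (K + N)) v' (Suc (K + N))" "v' \<noteq> []"
          using nontrivial_loop_exists[OF tr, of "Suc (K + N)"] by auto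
        moreover obtain v'' where "walk M (Suc (K + N)) v'' 1" using walk_exists[OF tr, of "Suc (K + N)" 1] by auto
        ultimately show ?thesis by (intro that[of "v' @ v''"]) (auto simp: walk_append)
      qed
      define w where "w = u @ v"
      have w: "walk M 1 w 1" "w \<noteq> []" using u v by (auto simp: w_def walk_append)
      let ?x = "periodic_seq w"
      have x: "?x \<in> markov_shift M" using w by (rule periodic_seq_markov_shift)
      \<comment> \<open>an occurrence of this symbol that is preceded by a full window\<close>
      define P where "P = length u + L * length w"
      have "P mod length w = length u" using v(2) by (simp add: P_def w_def)
      then have P: "?x P = Suc (K + N)" using v walk_hd[OF v] by (simp add: periodic_seq_def w_def nth_append)
      have "L * 1 \<le> L * length w" using w(2) by (intro mult_left_mono) (simp_all add: Suc_le_eq)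
      then have LP: "L \<le> P" unfolding P_def by linarith
      obtain i where i: "i < L" "?x (i + (P - L)) < N" using small[OF markov_shift_shift[OF x]] by blast
      obtain j where j: "j < L" "?x (j + P) < N" using small[OF markov_shift_shift[OF x]] by blast
      let ?i = "i + (P - L)" and ?j = "j + P"
      have "?i < P" using i(1) LP by simp
      have "j \<noteq> 0" using j(2) P by (cases j) auto
      then have "P < ?j" by simp
      have "walk M (?x ?i) (map ?x [?i..<?j]) (?x ?j)"
        using walk_of_markov_shift[OF x, of ?i ?j] \<open>?i < P\<close> by simp
      moreover have "length (map ?x [?i..<?j]) = j + (L - i)" using i(1) LP by simp
      moreover have "Suc (K + N) \<in> set (map ?x [?i..<?j])"
        unfolding set_map set_upt using \<open>?i < P\<close> \<open>P < ?j\<close> P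
        by (intro image_eqI[of _ _ P]) simp_all
      ultimately have "Q K (?x ?i, ?x ?j, j + (L - i))"
        unfolding Q_def prod.case by (intro exI[of _ "map ?x [?i..<?j]"] conjI bexI[of _ "Suc (K + N)"]) auto
      moreover have "(?x ?i, ?x ?j, j + (L - i)) \<in> ?I" using i j by auto
      ultimately show ?thesis by blast
    qed
    have "\<exists>q\<in>?I. \<forall>K. Q K q"
    proof (rule ccontr)
      assume "\<not> ?thesis"
      then obtain K where K: "\<And>q. q \<in> ?I \<Longrightarrow> \<not> Q (K q) q" by metis
      obtain q where q: "q \<in> ?I" "Q (Max (K ` ?I)) q" using Q by blast
      have "K q \<le> Max (K ` ?I)" using q(1) by (intro Max_ge) auto
      then have "Q (K q) q" using q(2) by (auto simp: Q_def split: prod.splits intro: order_trans)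
      with K[OF q(1)] show False by simp
    qed
    then obtain a b n where "\<And>K. Q K (a, b, n)" by auto
    then have "\<not> F_property M" unfolding Q_def by (intro unbounded_walks_imp_not_F[OF tr, of a b n]) auto
    with F show False by simp
  qed
  then show "\<exists>y\<in>markov_shift M. cylinder_close N L (\<lambda>_. \<infinity>) (embed_seq y)"
    by (auto simp: cylinder_close_def embed_seq_def)
qed (simp add: ext_sequences_def)

lemma dirac_infinity_ergodic_not_on_shift:
  assumes "(\<lambda>_. \<infinity>) \<in> compactification M"
  shows "dirac_infinity M \<in> ergodic_measures M \<inter> (invariant_measures M - invariant_measures_shift M)"
proof -
  have "dirac_infinity M \<in> invariant_measures M" using assms by (simp add: dirac_infinity_invariant)
  moreover have "emeasure (dirac_infinity M) A = 0 \<or> emeasure (dirac_infinity M) A = 1"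
    if "A \<in> sets (dirac_infinity M)" for A
    using that by (auto simp: dirac_infinity_def indicator_def)
  moreover have "(\<lambda>_. \<infinity>) \<notin> embed_seq ` markov_shift M" by (auto simp: embed_markov_shift_eq)
  then have "emeasure (dirac_infinity M) (embed_seq ` markov_shift M) = 0"
    using embed_markov_shift_measurable by (simp add: dirac_infinity_def)
  ultimately show ?thesis by (auto simp: ergodic_measures_def invariant_measures_shift_def)
qed

text \<open>
  The sets \<open>C j\<close> of points with a finite symbol at \<open>j\<close> followed by \<open>\<infinity>\<close> are preimages of each other
  under the shift, and they are disjoint by \<open>infinity_between_finite_imp_not_F\<close>; so they are null sets.
  Hence a finite coordinate is almost surely followed by finite coordinates only. The points whose
  coordinates are eventually finite form the invariant set \<open>\<Union>j. A j\<close>. Its measure is that of the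
  shift space, so by ergodicity it is \<open>0\<close>, and almost every point has no finite coordinate at all.
\<close>

lemma ergodic_not_on_shift_eq_dirac_infinity:
  assumes tr: "transitive_shift M" and F: "F_property M"
    and erg: "\<mu> \<in> ergodic_measures M" and not_shift: "\<mu> \<notin> invariant_measures_shift M"
  shows "\<mu> = dirac_infinity M"
proof -
  have inv: "\<mu> \<in> invariant_measures M" using erg by (simp add: ergodic_measures_def)
  note \<mu> = invariant_measuresD[OF inv]
  interpret prob_space \<mu> by (rule \<mu>(1))
  have coord: "{x \<in> compactification M. x n = \<infinity>} \<in> sets \<mu>" for n
  proof -
    have "continuous_map (compactification_topology M) euclideanreal (\<lambda>x. recip (x n))"
      unfolding compactification_topology_def by (intro continuous_map_from_subtopology continuous_map_recip)
    from measurable_sets[OF borel_measurable_continuous[OF this], of "{0}"]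
    have "(\<lambda>x. recip (x n)) -` {0} \<inter> compactification M \<in> sets \<mu>" by (simp add: \<mu>(2))
    moreover have "recip (x n) = 0 \<longleftrightarrow> x n = \<infinity>" if "x \<in> compactification M" for x
      using compactification_ge_1[OF that, of n] by (cases "x n") (auto simp: recip_def one_enat_def)
    then have "(\<lambda>x. recip (x n)) -` {0} \<inter> compactification M = {x \<in> compactification M. x n = \<infinity>}" by auto
    ultimately show ?thesis by simp
  qed
  then have fin: "{x \<in> compactification M. x n \<noteq> \<infinity>} \<in> sets \<mu>" for n
  proof -
    have "{x \<in> compactification M. x n \<noteq> \<infinity>} = space \<mu> - {x \<in> compactification M. x n = \<infinity>}"
      by (auto simp: \<mu>(3))
    then show ?thesis using coord by simp
  qed
  have shift_mem: "x \<in> compactification M \<Longrightarrow> left_shift x \<in> compactification M" for x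
    using shift_compactification by blast
  define C where "C j = {x \<in> compactification M. x j \<noteq> \<infinity> \<and> x (Suc j) = \<infinity>}" for j
  have C_sets: "C j \<in> sets \<mu>" for j
  proof -
    have "C j = {x \<in> compactification M. x j \<noteq> \<infinity>} \<inter> {x \<in> compactification M. x (Suc j) = \<infinity>}"
      by (auto simp: C_def)
    then show ?thesis using fin coord by auto
  qed
  have C_shift: "measure \<mu> (C j) = measure \<mu> (C 0)" for j
  proof (induction j)
    case (Suc j)
    have "left_shift -` C j \<inter> space \<mu> = C (Suc j)"
      using shift_mem by (auto simp: C_def \<mu>(3) left_shift_def)
    then show ?case using \<mu>(4)[OF C_sets[of j]] Suc by (simp add: measure_def)
  qed simp
  have C_later: "x k = \<infinity>" if "x \<in> C j" "j < k" for x j k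
  proof (cases "k = Suc j")
    case False
    with that have "Suc j < k" and x: "x \<in> compactification M" "x j \<noteq> \<infinity>" "x (Suc j) = \<infinity>"
      by (simp_all add: C_def)
    then show ?thesis
      using infinity_between_finite_imp_not_F[OF tr x(1) lessI _ x(2,3)] F by blast
  qed (use that in \<open>simp add: C_def\<close>)
  have "disjoint_family C"
    unfolding disjoint_family_on_def
  proof (intro ballI impI)
    fix j k :: nat assume "j \<noteq> k"
    show "C j \<inter> C k = {}"
    proof (intro equals0I)
      fix x assume x: "x \<in> C j \<inter> C k"
      then have "x j \<noteq> \<infinity>" "x k \<noteq> \<infinity>" by (simp_all add: C_def)
      with x C_later[of x j k] C_later[of x k j] \<open>j \<noteq> k\<close> show False
        by (metis IntD1 IntD2 linorder_neqE_nat)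
    qed
  qed
  have C0: "measure \<mu> (C 0) = 0"
  proof (rule ccontr)
    assume "measure \<mu> (C 0) \<noteq> 0"
    then have "0 < measure \<mu> (C 0)" by (simp add: zero_less_measure_iff)
    from ex_less_of_nat_mult[OF this, of 1] obtain n where n: "1 < real n * measure \<mu> (C 0)" by auto
    have "measure \<mu> (\<Union>j\<in>{..<n}. C j) = (\<Sum>j<n. measure \<mu> (C j))"
      by (intro finite_measure_finite_Union)
         (use C_sets \<open>disjoint_family C\<close> in \<open>auto simp: disjoint_family_on_def\<close>)
    also have "\<dots> = (\<Sum>j<n. measure \<mu> (C 0))" by (intro sum.cong refl C_shift)
    finally show False using n prob_le_1[of "\<Union>j\<in>{..<n}. C j"] by simp
  qed
  have C_null: "AE x in \<mu>. x \<notin> C j" for j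
    using C_shift[of j] C0 C_sets[of j]
    by (intro AE_not_in) (auto simp: null_sets_def emeasure_eq_measure)
  define A where "A j = {x \<in> compactification M. \<forall>n\<ge>j. x n \<noteq> \<infinity>}" for j :: nat
  have A_sets: "A j \<in> sets \<mu>" for j
  proof -
    have "A j = (\<Inter>n\<in>{j..}. {x \<in> compactification M. x n \<noteq> \<infinity>})" by (auto simp: A_def)
    then show ?thesis using fin by (auto intro!: sets.countable_INT')
  qed
  have A_shift: "emeasure \<mu> (A j) = emeasure \<mu> (A 0)" for j
  proof (induction j)
    case (Suc j)
    have "left_shift -` A j \<inter> space \<mu> = A (Suc j)"
    proof -
      have "(\<forall>n\<ge>j. x (Suc n) \<noteq> \<infinity>) \<longleftrightarrow> (\<forall>n\<ge>Suc j. x n \<noteq> \<infinity>)" for x :: "nat \<Rightarrow> enat"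
        by (metis Suc_le_D Suc_le_mono)
      then show ?thesis using shift_mem by (auto simp: A_def \<mu>(3) left_shift_def)
    qed
    then show ?case using \<mu>(4)[OF A_sets[of j]] Suc by simp
  qed simp
  have "incseq A" unfolding incseq_def A_def by force
  then have "emeasure \<mu> (\<Union>j. A j) = (SUP j. emeasure \<mu> (A j))"
    using A_sets by (intro SUP_emeasure_incseq[symmetric]) auto
  also have "\<dots> = (SUP j::nat. emeasure \<mu> (A 0))"
    by (intro SUP_cong refl A_shift)
  also have "\<dots> = emeasure \<mu> (A 0)" by simp
  also have "A 0 = embed_seq ` markov_shift M" by (auto simp: A_def embed_markov_shift_eq)
  also have "emeasure \<mu> \<dots> \<noteq> 1" using not_shift inv by (simp add: invariant_measures_shift_def)
  finally have "emeasure \<mu> (\<Union>j. A j) \<noteq> 1" .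
  moreover have "left_shift -` (\<Union>j. A j) \<inter> space \<mu> = (\<Union>j. A j)"
  proof -
    have tail: "(\<exists>j. \<forall>n\<ge>j. left_shift x n \<noteq> \<infinity>) \<longleftrightarrow> (\<exists>j. \<forall>n\<ge>j. x n \<noteq> \<infinity>)" for x :: "nat \<Rightarrow> enat"
      unfolding left_shift_def by (metis Suc_le_D Suc_le_mono le_SucI)
    have U: "(\<Union>j. A j) = {x \<in> compactification M. \<exists>j. \<forall>n\<ge>j. x n \<noteq> \<infinity>}"
      by (auto simp: A_def)
    show ?thesis
    proof (rule set_eqI)
      fix x
      show "x \<in> left_shift -` (\<Union>j. A j) \<inter> space \<mu> \<longleftrightarrow> x \<in> (\<Union>j. A j)"
        unfolding U Int_iff vimage_eq mem_Collect_eq tail \<mu>(3) using shift_mem by blast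
    qed
  qed
  moreover have "(\<Union>j. A j) \<in> sets \<mu>" using A_sets by (intro sets.countable_UN) auto
  moreover have "\<forall>S\<in>sets \<mu>. left_shift -` S \<inter> space \<mu> = S \<longrightarrow> emeasure \<mu> S = 0 \<or> emeasure \<mu> S = 1"
    using erg by (simp add: ergodic_measures_def)
  ultimately have "emeasure \<mu> (\<Union>j. A j) = 0" by metis
  then have A_null: "AE x in \<mu>. x \<notin> (\<Union>j. A j)"
    using A_sets by (intro AE_not_in) (auto simp: null_sets_def)
  have "AE x in \<mu>. \<forall>j. x \<notin> C j" using C_null by (simp add: AE_all_countable)
  with A_null AE_space[of \<mu>] have AE_inf: "AE x in \<mu>. x = (\<lambda>_. \<infinity>)"
  proof eventually_elim
    case (elim x)
    then have x: "x \<in> compactification M" by (simp add: \<mu>(3))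
    have "x j = \<infinity>" for j
    proof (rule ccontr)
      assume j: "x j \<noteq> \<infinity>"
      have "x n \<noteq> \<infinity>" if "j \<le> n" for n
        using that
      proof (induction n rule: dec_induct)
        case (step n)
        from elim(3) have "x \<notin> C n" by blast
        with step.IH x show ?case by (simp add: C_def)
      qed (rule j)
      then have "x \<in> A j" using x by (simp add: A_def)
      with elim(1) show False by blast
    qed
    then show ?case by auto
  qed
  show ?thesis
  proof (rule measure_eqI)
    show "sets \<mu> = sets (dirac_infinity M)" by (simp add: \<mu>(2) dirac_infinity_def)
    fix S assume S: "S \<in> sets \<mu>"
    have "emeasure \<mu> S = indicator S (\<lambda>_. \<infinity>)"
    proof (cases "(\<lambda>_. \<infinity>) \<in> S")
      case True
      from AE_inf have "AE x in \<mu>. x \<in> S" by eventually_elim (simp add: True)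
      with S True show ?thesis by (simp add: emeasure_eq_1_AE)
    next
      case False
      from AE_inf have "AE x in \<mu>. x \<notin> S" by eventually_elim (simp add: False)
      then have "S \<in> null_sets \<mu>" using AE_iff_null_sets[OF S] by blast
      with False show ?thesis by (simp add: null_sets_def)
    qed
    then show "emeasure \<mu> S = emeasure (dirac_infinity M) S"
      using S by (simp add: dirac_infinity_def \<mu>(2))
  qed
qed

theorem theorem1p2:
  fixes M :: "nat \<Rightarrow> nat \<Rightarrow> nat"
  assumes "transition_matrix M" and "transitive_shift M"
  shows "(F_property M \<longleftrightarrow>
            ergodic_measures M \<inter> (invariant_measures M - invariant_measures_shift M) = {dirac_infinity M})
       \<and> (\<not> F_property M \<longleftrightarrow>
            weak_star_topology M closure_of
              (ergodic_measures M \<inter> (invariant_measures M - invariant_measures_shift M)) =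
            invariant_measures M)"
proof -
  let ?E = "ergodic_measures M \<inter> (invariant_measures M - invariant_measures_shift M)"
  have 1: "?E = {dirac_infinity M}" if "F_property M"
    using ergodic_not_on_shift_eq_dirac_infinity[OF assms(2) that]
      dirac_infinity_ergodic_not_on_shift[OF infinity_in_compactification[OF assms(2) that]] by blast
  have 2: "weak_star_topology M closure_of ?E = invariant_measures M" if "\<not> F_property M"
    using assms(2) that by (rule dense_of_not_F)
  show ?thesis using 1 2 closure_dirac_infinity[OF assms(2)] by metis
qed

end
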